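(* Let $M$ be a compact smooth manifold without boundary, of dimension $d\ge 1$. Fix $t>0$. For $i=1,2$, let $\iota_i:M\to\mathbb{R}^{D}$ be $C^2$ embeddings, denote the induced metrics by $g_i:=\iota_i^*\langle\cdot,\cdot\rangle_{\mathbb{R}^{D}}$, and set $$\mu_i:=\mu_{g_i},\qquad K_i(x,y):=\exp\Big(-\frac{\|\iota_i(x)-\iota_i(y)\|^2}{t}\Big).$$ Let $p_1,p_2\in C(M)$ satisfy $p_i>0$ on $M$. Assume $$L^{\mathrm{ext}}_{t,p_1}(g_1;\iota_1)=L^{\mathrm{ext}}_{t,p_2}(g_2;\iota_2)\quad\text{as operators on }C(M),$$ where $$L^{\mathrm{ext}}_{t,p_i}(g_i;\iota_i)(f)(x):=\frac{1}{t^{\frac d2+1}}\int_M K_i(x,y)\,\bigl(f(x)-f(y)\bigr)\,p_i(y)\,d\mu_i(y),\qquad f\in C(M),\ x\in M.$$ Then $$\|\iota_1(x)-\iota_1(y)\|=\|\iota_2(x)-\iota_2(y)\|\quad\text{for all }x,y\in M,$$ and consequently $g_1=g_2$, $\mu_1=\mu_2$, and $p_1=p_2$ on $M$.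
   Context: $C(M)$ denotes the space of continuous real-valued functions on $M$. For a Riemannian metric $g$ on $M$, $\mu_g$ denotes its Riemannian volume measure. $\langle\cdot,\cdot\rangle_{\mathbb{R}^D}$ and $\|\cdot\|$ are the Euclidean inner product and norm on $\mathbb{R}^D$, and $\iota_i^*$ denotes pullback, so $g_i(x)(v,w)=\langle d\iota_i(x)[v],d\iota_i(x)[w]\rangle$. *)

theory Defs
  imports "HOL-Analysis.Analysis"
begin

section \<open>Maps of class $C^k$ between Euclidean spaces\<close>

text \<open>For open \<open>S\<close> in a finite-dimensional space. The predicate at \<open>Suc n\<close> asks for
  differentiability on \<open>S\<close> and for all directional derivatives to be of class $C^n$; the
  latter gives back continuity of the derivative itself.\<close>

fun Ck_on :: "nat \<Rightarrow> 'a::euclidean_space set \<Rightarrow> ('a \<Rightarrow> 'b::euclidean_space) \<Rightarrow> bool" where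
  "Ck_on 0 S f \<longleftrightarrow> continuous_on S f"
| "Ck_on (Suc n) S f \<longleftrightarrow> (\<forall>x\<in>S. f differentiable (at x)) \<and>
     (\<forall>v. Ck_on n S (\<lambda>x. frechet_derivative f (at x) v))"


section \<open>Smooth manifolds without boundary\<close>

text \<open>The underlying set of the manifold is a whole type \<open>'m\<close>. A chart is a pair of a domain
  and a coordinate map; the values of the coordinate map outside the domain are irrelevant.\<close>

type_synonym ('m, 'e) chart = "'m set \<times> ('m \<Rightarrow> 'e)"

definition chart_inv :: "('m, 'e) chart \<Rightarrow> 'e \<Rightarrow> 'm" where
  "chart_inv c = inv_into (fst c) (snd c)"

definition is_chart :: "('m::topological_space, 'e::euclidean_space) chart \<Rightarrow> bool" where
  "is_chart c \<longleftrightarrow> open (fst c) \<and> open (snd c ` fst c) \<and>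
     homeomorphism (fst c) (snd c ` fst c) (snd c) (chart_inv c)"

text \<open>The atlas need not be maximal. None of the notions below changes when it is replaced by
  another atlas of the same smooth structure.\<close>

definition smooth_atlas :: "('m::topological_space, 'e::euclidean_space) chart set \<Rightarrow> bool" where
  "smooth_atlas A \<longleftrightarrow> (\<forall>c\<in>A. is_chart c) \<and> (\<Union>c\<in>A. fst c) = UNIV \<and>
     (\<forall>c\<in>A. \<forall>c'\<in>A. \<forall>k. Ck_on k (snd c ` (fst c \<inter> fst c')) (snd c' \<circ> chart_inv c))"

text \<open>A tangent vector at \<open>x\<close> is the family of its coordinate representations in all charts
  around \<open>x\<close>, which transform by the differentials of the transition maps; the family is set to
  \<open>0\<close> at all other indices to make the representation unique.\<close>

type_synonym ('m, 'e) tangent_vector = "('m, 'e) chart \<Rightarrow> 'e"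

definition charts_at :: "('m, 'e) chart set \<Rightarrow> 'm \<Rightarrow> ('m, 'e) chart set" where
  "charts_at A x = {c \<in> A. x \<in> fst c}"

definition transition_diff ::
  "'m \<Rightarrow> ('m, 'e::euclidean_space) chart \<Rightarrow> ('m, 'e) chart \<Rightarrow> 'e \<Rightarrow> 'e" where
  "transition_diff x c c' = frechet_derivative (snd c' \<circ> chart_inv c) (at (snd c x))"

definition tangent_space ::
  "('m, 'e::euclidean_space) chart set \<Rightarrow> 'm \<Rightarrow> ('m, 'e) tangent_vector set" where
  "tangent_space A x = {v. (\<forall>c. c \<notin> charts_at A x \<longrightarrow> v c = 0) \<and>
     (\<forall>c\<in>charts_at A x. \<forall>c'\<in>charts_at A x. v c' = transition_diff x c c' (v c))}"

text \<open>The tangent vector at \<open>x\<close> whose representation in the chart \<open>c\<close> around \<open>x\<close> is \<open>u\<close>.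
  For \<open>u = axis i 1\<close> it is the \<open>i\<close>-th coordinate vector of \<open>c\<close>.\<close>

definition coord_vector ::
  "('m, 'e::euclidean_space) chart set \<Rightarrow> ('m, 'e) chart \<Rightarrow> 'm \<Rightarrow> 'e \<Rightarrow> ('m, 'e) tangent_vector"
  where
  "coord_vector A c x u = (\<lambda>c'. if c' \<in> charts_at A x then transition_diff x c c' u else 0)"


section \<open>Embeddings into Euclidean space\<close>

definition Ck_map :: "nat \<Rightarrow> ('m, 'e::euclidean_space) chart set \<Rightarrow> ('m \<Rightarrow> 'b::euclidean_space) \<Rightarrow> bool"
  where
  "Ck_map k A F \<longleftrightarrow> (\<forall>c\<in>A. Ck_on k (snd c ` fst c) (F \<circ> chart_inv c))"

text \<open>On tangent vectors the value does not depend on the chart that is chosen.\<close>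

definition differential ::
  "('m, 'e::euclidean_space) chart set \<Rightarrow> ('m \<Rightarrow> 'b::euclidean_space) \<Rightarrow> 'm \<Rightarrow>
     ('m, 'e) tangent_vector \<Rightarrow> 'b" where
  "differential A F x v =
     (let c = (SOME c. c \<in> charts_at A x)
      in frechet_derivative (F \<circ> chart_inv c) (at (snd c x)) (v c))"

definition Ck_embedding ::
  "nat \<Rightarrow> ('m::topological_space, 'e::euclidean_space) chart set \<Rightarrow> ('m \<Rightarrow> 'b::euclidean_space) \<Rightarrow> bool"
  where
  "Ck_embedding k A F \<longleftrightarrow> Ck_map k A F \<and>
     (\<forall>x. inj_on (differential A F x) (tangent_space A x)) \<and>
     (\<exists>G. homeomorphism UNIV (range F) F G)"


section \<open>Riemannian metrics and volume\<close>

text \<open>Only the values of a metric at \<open>x\<close> on \<open>tangent_space A x\<close> are meaningful.\<close>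

type_synonym ('m, 'e) metric =
  "'m \<Rightarrow> ('m, 'e) tangent_vector \<Rightarrow> ('m, 'e) tangent_vector \<Rightarrow> real"

definition pullback_metric ::
  "('m, 'e::euclidean_space) chart set \<Rightarrow> ('m \<Rightarrow> 'b::euclidean_space) \<Rightarrow> ('m, 'e) metric" where
  "pullback_metric A F x v w = differential A F x v \<bullet> differential A F x w"

definition metric_matrix ::
  "('m, real^'d) chart set \<Rightarrow> ('m, real^'d) metric \<Rightarrow> ('m, real^'d) chart \<Rightarrow> 'm \<Rightarrow> real^'d^'d" where
  "metric_matrix A g c x =
     (\<chi> i j. g x (coord_vector A c x (axis i 1)) (coord_vector A c x (axis j 1)))"

text \<open>The unique Borel measure that in every chart has the density $\sqrt{\det (g_{ij})}$ with
  respect to Lebesgue measure.\<close>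

definition riemannian_volume ::
  "('m::topological_space, real^'d) chart set \<Rightarrow> ('m, real^'d) metric \<Rightarrow> 'm measure" where
  "riemannian_volume A g = (THE \<mu>. sets \<mu> = sets borel \<and>
     (\<forall>c\<in>A. \<forall>B\<in>sets borel. B \<subseteq> fst c \<longrightarrow>
        emeasure \<mu> B =
          (\<integral>\<^sup>+y\<in>snd c ` B. ennreal (sqrt (det (metric_matrix A g c (chart_inv c y)))) \<partial>lborel)))"


section \<open>The extrinsic graph Laplacian\<close>

definition gauss_kernel :: "real \<Rightarrow> ('m \<Rightarrow> 'b::euclidean_space) \<Rightarrow> 'm \<Rightarrow> 'm \<Rightarrow> real" where
  "gauss_kernel t F x y = exp (- ((norm (F x - F y))\<^sup>2 / t))"

definition L_ext ::
  "('m::topological_space, real^'d) chart set \<Rightarrow> real \<Rightarrow> ('m \<Rightarrow> real) \<Rightarrow> ('m, real^'d) metric \<Rightarrow>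
     ('m \<Rightarrow> 'b::euclidean_space) \<Rightarrow> ('m \<Rightarrow> real) \<Rightarrow> 'm \<Rightarrow> real" where
  "L_ext A t p g F f x =
     1 / t powr (real CARD('d) / 2 + 1) *
       (\<integral>y. gauss_kernel t F x y * (f x - f y) * p y \<partial>riemannian_volume A g)"

end

theory Submission
  imports Defs
begin

text \<open>
  Write \<open>\<mu>\<^sub>i\<close> and \<open>K\<^sub>i\<close> for the volume measures and the kernels of the two embeddings. At a point \<open>x\<close>
  and for a function \<open>f\<close> with \<open>f x = 0\<close>, the operator is a constant multiple of the integral of \<open>f\<close>
  against the measure \<open>K\<^sub>i(x,y) p\<^sub>i(y) d\<mu>\<^sub>i(y)\<close>. The volume measures have no atoms, so equality of the
  operators says that for each \<open>x\<close> the two measures \<open>K\<^sub>1(x,y) p\<^sub>1(y) d\<mu>\<^sub>1(y)\<close> and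
  \<open>K\<^sub>2(x,y) p\<^sub>2(y) d\<mu>\<^sub>2(y)\<close> coincide (\<open>finite_measure_eqI_vanishing\<close>).

  Hence \<open>p\<^sub>2 d\<mu>\<^sub>2\<close> has the density \<open>K\<^sub>1(x,y) / K\<^sub>2(x,y)\<close> with respect to \<open>p\<^sub>1 d\<mu>\<^sub>1\<close>, for every \<open>x\<close>.
  The left hand side does not involve \<open>x\<close>; as \<open>\<mu>\<^sub>1\<close> charges every nonempty open set and the ratio is
  continuous in \<open>y\<close>, the ratio is independent of \<open>x\<close> (\<open>continuous_eqI_density\<close>). At \<open>x = y\<close> it equals
  \<open>1\<close>, so \<open>K\<^sub>1 = K\<^sub>2\<close>, and taking logarithms shows that the Euclidean distances agree. Differentiating the
  distances gives equal metrics (\<open>isometric_imp_pullback_metric_eq\<close>) and with them equal volumes; then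
  \<open>p\<^sub>1\<close> and \<open>p\<^sub>2\<close> are continuous densities of one measure, and agree.

  This uses that the Riemannian volume is finite, has no atoms and is positive on nonempty open
  sets (\<open>riemannian_volume_embedding\<close>). It is given by a definite description, so its existence and
  uniqueness have to be shown. The chart densities $\sqrt{\det (g_{ij})}$ transform by the
  Jacobian determinants of the transition maps (\<open>det_metric_matrix_change_chart\<close>); the change of
  variables formula makes the local volumes agree on overlaps, and summation over a countable
  partition into pieces of chart domains glues them (\<open>volume_exists\<close>, \<open>volume_unique\<close>).
\<close>

section \<open>Change of variables with an arbitrary finite index type\<close>

lemma det_reindex:
  fixes f :: "'m::finite \<Rightarrow> 'n::finite" and M :: "real^'n^'n"
  assumes "bij f"
  shows "det (\<chi> i j. M $ f i $ f j) = det M"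
proof -
  let ?P = "{p. p permutes (UNIV :: 'm set)}" and ?Q = "{p. p permutes (UNIV :: 'n set)}"
  let ?h = "map_permutation UNIV f"
  have inj: "inj f" and surj: "range f = UNIV"
    using assms by (auto simp: bij_def)
  have bij: "bij_betw ?h ?P ?Q"
  proof (rule bij_betw_byWitness[where f' = "map_permutation UNIV (inv f)"])
    show "\<forall>p\<in>?P. map_permutation UNIV (inv f) (?h p) = p"
      using map_permutation_compose_inv[OF assms] inj by simp
    show "\<forall>q\<in>?Q. ?h (map_permutation UNIV (inv f) q) = q"
      using map_permutation_compose_inv[OF bij_imp_bij_inv[OF assms]] surj by (simp add: surj_f_inv_f)
  qed (use map_permutation_permutes assms bij_imp_bij_inv in blast)+
  have app: "?h p (f i) = f (p i)" for p i
    using inj by (simp add: map_permutation_apply)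
  have "det M = (\<Sum>p\<in>?P. of_int (sign (?h p)) * (\<Prod>i\<in>UNIV. M $ i $ ?h p i))"
    unfolding det_def by (rule sum.reindex_bij_betw[OF bij, symmetric])
  also have "\<dots> = (\<Sum>p\<in>?P. of_int (sign p) * (\<Prod>i\<in>UNIV. M $ f i $ f (p i)))"
  proof (rule sum.cong[OF refl])
    fix p assume "p \<in> ?P"
    then have "sign (?h p) = sign p"
      using inj by (intro sign_map_permutation) auto
    moreover have "(\<Prod>i\<in>UNIV. M $ i $ ?h p i) = (\<Prod>i\<in>UNIV. M $ f i $ f (p i))"
      using prod.reindex_bij_betw[OF assms, of "\<lambda>i. M $ i $ ?h p i"] by (simp add: app)
    ultimately show "of_int (sign (?h p)) * (\<Prod>i\<in>UNIV. M $ i $ ?h p i) =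
        of_int (sign p) * (\<Prod>i\<in>UNIV. M $ f i $ f (p i))" by simp
  qed
  finally show ?thesis by (simp add: det_def)
qed

lemma prod_inner_Basis_vec:
  fixes w :: "real^'n::finite"
  shows "(\<Prod>b\<in>Basis. w \<bullet> b) = (\<Prod>i\<in>UNIV. w $ i)"
proof -
  have inj: "inj (\<lambda>i::'n. axis i (1::real))"
    by (simp add: inj_on_def axis_eq_axis)
  have "Basis = range (\<lambda>i::'n. axis i (1::real))"
    by (auto simp: Basis_vec_def)
  then have "(\<Prod>b\<in>Basis. w \<bullet> b) = (\<Prod>b\<in>range (\<lambda>i::'n. axis i (1::real)). w \<bullet> b)"
    by (rule prod.cong) simp
  also have "\<dots> = (\<Prod>i\<in>UNIV. w $ i)"
    by (subst prod.reindex[OF inj]) (simp add: o_def inner_axis)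
  finally show ?thesis .
qed

lemma lborel_distr_reindex:
  fixes f :: "'m::finite \<Rightarrow> 'n::finite"
  assumes "bij f"
  shows "distr lborel borel (\<lambda>v::real^'n. \<chi> i. v $ f i) = lborel"
proof (rule lborel_eqI[symmetric])
  let ?J = "\<lambda>v::real^'n. \<chi> i. v $ f i"
  have [measurable]: "?J \<in> borel_measurable borel"
    by (intro borel_measurable_continuous_onI continuous_intros)
  have fi: "f (inv f j) = j" "inv f (f i) = i" for i j
    using assms by (simp_all add: bij_is_surj surj_f_inv_f bij_is_inj)
  fix l u :: "real^'m" assume le: "\<And>b. b \<in> Basis \<Longrightarrow> l \<bullet> b \<le> u \<bullet> b"
  have lu: "l $ i \<le> u $ i" for i
    using le[of "axis i 1"] by (simp add: inner_axis)
  let ?l = "\<chi> j. l $ inv f j" and ?u = "\<chi> j. u $ inv f j"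
  have "?J -` box l u = box ?l ?u"
    by (auto simp: mem_box_cart) (metis fi)+
  moreover have "?l \<bullet> b \<le> ?u \<bullet> b" if "b \<in> Basis" for b
    using lu that by (auto simp: Basis_vec_def inner_axis)
  ultimately have "emeasure (distr lborel borel ?J) (box l u) = (\<Prod>b\<in>Basis. (?u - ?l) \<bullet> b)"
    by (simp add: emeasure_distr emeasure_lborel_box)
  also have "\<dots> = (\<Prod>j\<in>UNIV. (?u - ?l) $ j)"
    by (simp only: prod_inner_Basis_vec)
  also have "\<dots> = (\<Prod>i\<in>UNIV. (u - l) $ i)"
    using prod.reindex_bij_betw[OF assms, of "\<lambda>j. (?u - ?l) $ j"] by (simp add: fi)
  also have "\<dots> = (\<Prod>b\<in>Basis. (u - l) \<bullet> b)"
    by (simp only: prod_inner_Basis_vec)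
  finally show "emeasure (distr lborel borel ?J) (box l u) = (\<Prod>b\<in>Basis. (u - l) \<bullet> b)" .
qed simp

text \<open>The classical change of variables formula is applied over coordinate spaces whose index type
  is well-ordered. This copy of a finite type carries such an order, pulled back from an
  enumeration; by the two reindexing lemmas, relabelling the coordinates changes neither
  Lebesgue measure nor determinants, so the formula passes to all finite index types.\<close>

typedef 'a enumerated = "UNIV :: 'a set" morphisms index_of enum_of
  by simp

instance enumerated :: (finite) finite
proof
  have "(UNIV :: 'a enumerated set) = range enum_of"
    by (metis UNIV_eq_I index_of_inverse rangeI)
  then show "finite (UNIV :: 'a enumerated set)" by (metis finite finite_imageI)
qed

instantiation enumerated :: (finite) wellorder
begin

definition "x \<le> y \<longleftrightarrow> to_nat_on UNIV (index_of x) \<le> to_nat_on UNIV (index_of y)"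
definition "x < y \<longleftrightarrow> to_nat_on UNIV (index_of x) < to_nat_on UNIV (index_of y)"

instance
proof
  fix x y z :: "'a enumerated"
  show "x < y \<longleftrightarrow> x \<le> y \<and> \<not> y \<le> x" "x \<le> x" "x \<le> y \<or> y \<le> x"
    by (auto simp: less_eq_enumerated_def less_enumerated_def)
  show "x \<le> y \<Longrightarrow> y \<le> z \<Longrightarrow> x \<le> z"
    by (simp add: less_eq_enumerated_def)
  have "inj (to_nat_on (UNIV :: 'a set))"
    by (simp add: countable_finite inj_on_to_nat_on)
  then show "x \<le> y \<Longrightarrow> y \<le> x \<Longrightarrow> x = y"
    by (simp add: less_eq_enumerated_def index_of_inject inj_eq)
  fix P :: "'a enumerated \<Rightarrow> bool" and a :: "'a enumerated"
  assume step: "\<And>x. (\<And>y. y < x \<Longrightarrow> P y) \<Longrightarrow> P x"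
  show "P a"
    by (induction a rule: measure_induct_rule[of "\<lambda>x. to_nat_on UNIV (index_of x)"])
       (rule step, simp add: less_enumerated_def)
qed

end

lemma bij_index_of: "bij (index_of :: 'a enumerated \<Rightarrow> 'a)"
  by (metis bijI' index_of_inject enum_of_inverse UNIV_I)

text \<open>The change of variables theorem is an equivalence: one side is integrable with value \<open>b\<close> if and
  only if the other is. For nonnegative integrands this gives equality of the extended integrals,
  since the value \<open>\<infinity>\<close> is then attained on both sides or on neither.\<close>

lemma nn_integral_change_of_variables_wellorder:
  fixes T :: "real^'n::{finite,wellorder} \<Rightarrow> real^'n::_" and f :: "real^'n::_ \<Rightarrow> real"
  assumes S: "S \<in> sets borel"
    and der: "\<And>x. x \<in> S \<Longrightarrow> (T has_derivative T' x) (at x within S)"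
    and inj: "inj_on T S"
    and f0: "\<And>y. 0 \<le> f y"
    and fm: "(\<lambda>y. indicator (T ` S) y * f y) \<in> borel_measurable borel"
    and gm: "(\<lambda>x. indicator S x * (\<bar>det (matrix (T' x))\<bar> * f (T x))) \<in> borel_measurable borel"
  shows "(\<integral>\<^sup>+y\<in>T ` S. ennreal (f y) \<partial>lborel) =
    (\<integral>\<^sup>+x\<in>S. ennreal (\<bar>det (matrix (T' x))\<bar> * f (T x)) \<partial>lborel)"
proof -
  let ?g = "\<lambda>x. \<bar>det (matrix (T' x))\<bar> * f (T x)"
  have int_iff: "(?g has_integral b) S \<longleftrightarrow> (f has_integral b) (T ` S)" for b
  proof -
    have "(\<lambda>x. \<bar>det (matrix (T' x))\<bar> *\<^sub>R (vec (f (T x)) :: real^1)) absolutely_integrable_on S \<and>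
        integral S (\<lambda>x. \<bar>det (matrix (T' x))\<bar> *\<^sub>R (vec (f (T x)) :: real^1)) = vec b
      \<longleftrightarrow> (\<lambda>y. vec (f y) :: real^1) absolutely_integrable_on (T ` S) \<and>
        integral (T ` S) (\<lambda>y. vec (f y) :: real^1) = vec b"
      using S by (intro has_absolute_integral_change_of_variables der inj) auto
    then have "?g absolutely_integrable_on S \<and> integral S ?g = b
        \<longleftrightarrow> f absolutely_integrable_on (T ` S) \<and> integral (T ` S) f = b"
      by (simp add: absolutely_integrable_on_1_iff integral_on_1_eq)
    moreover have "?g absolutely_integrable_on S \<longleftrightarrow> ?g integrable_on S"
      using f0 by (intro absolutely_integrable_on_iff_nonneg) auto
    moreover have "f absolutely_integrable_on T ` S \<longleftrightarrow> f integrable_on T ` S"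
      using f0 by (intro absolutely_integrable_on_iff_nonneg) auto
    ultimately show ?thesis by (simp add: has_integral_iff)
  qed
  have eq: "integral\<^sup>N lborel (\<lambda>y. ennreal (indicator A y * h y)) = ennreal b \<longleftrightarrow> (h has_integral b) A"
    if "0 \<le> b" "\<And>y. 0 \<le> h y" "(\<lambda>y. indicator A y * h y) \<in> borel_measurable borel"
    for A b and h :: "real^'n::_ \<Rightarrow> real"
  proof -
    have *: "(\<lambda>y. indicator A y * h y) = (\<lambda>y. if y \<in> A then h y else 0)"
      by (auto simp: indicator_def)
    have "(h has_integral b) A \<longleftrightarrow> ((\<lambda>y. indicator A y * h y) has_integral b) UNIV"
      unfolding * has_integral_restrict_UNIV ..
    then show ?thesis
      using that nn_integral_has_integral[of "\<lambda>y. indicator A y * h y" b]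
        nn_integral_has_integral_lborel[of "\<lambda>y. indicator A y * h y" b]
      by (auto simp: zero_le_mult_iff)
  qed
  have conv: "(\<integral>\<^sup>+y\<in>A. ennreal (h y) \<partial>lborel) = integral\<^sup>N lborel (\<lambda>y. ennreal (indicator A y * h y))"
    for A and h :: "real^'n::_ \<Rightarrow> real"
    by (intro nn_integral_cong) (auto simp: indicator_def)
  have g0: "0 \<le> ?g x" for x using f0 by simp
  have *: "(\<integral>\<^sup>+y\<in>T ` S. ennreal (f y) \<partial>lborel) = ennreal b \<longleftrightarrow>
      (\<integral>\<^sup>+x\<in>S. ennreal (?g x) \<partial>lborel) = ennreal b" if "0 \<le> b" for b
    unfolding conv using eq[OF that f0 fm] eq[OF that g0 gm] int_iff by simp
  show ?thesis
  proof (cases "(\<integral>\<^sup>+x\<in>S. ennreal (?g x) \<partial>lborel)" rule: ennreal_cases)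
    case top
    then show ?thesis
      by (cases "(\<integral>\<^sup>+y\<in>T ` S. ennreal (f y) \<partial>lborel)" rule: ennreal_cases)
         (use * in \<open>metis ennreal_neq_top\<close>, simp)
  qed (use * in simp)
qed

text \<open>Conjugation with the relabelling \<open>?J\<close> of the coordinates turns \<open>T\<close> into the map \<open>?U\<close> between
  well-ordered coordinate spaces.\<close>

lemma nn_integral_change_of_variables:
  fixes T :: "real^'n \<Rightarrow> real^'n" and f :: "real^'n \<Rightarrow> real"
  assumes S: "S \<in> sets borel"
    and der: "\<And>x. x \<in> S \<Longrightarrow> (T has_derivative T' x) (at x)"
    and inj: "inj_on T S"
    and f0: "\<And>y. 0 \<le> f y"
    and fm: "(\<lambda>y. indicator (T ` S) y * f y) \<in> borel_measurable borel"
    and gm: "(\<lambda>x. indicator S x * (\<bar>det (matrix (T' x))\<bar> * f (T x))) \<in> borel_measurable borel"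
  shows "(\<integral>\<^sup>+y\<in>T ` S. ennreal (f y) \<partial>lborel) =
    (\<integral>\<^sup>+x\<in>S. ennreal (\<bar>det (matrix (T' x))\<bar> * f (T x)) \<partial>lborel)"
proof -
  let ?J = "\<lambda>v::real^'n. (\<chi> i. v $ index_of i) :: real^'n enumerated"
  let ?I = "\<lambda>v::real^'n enumerated. (\<chi> i. v $ enum_of i) :: real^'n"
  have IJ [simp]: "?I (?J v) = v" and JI [simp]: "?J (?I w) = w" for v w
    by (simp_all add: enum_of_inverse index_of_inverse)
  have Jeq: "?J v = ?J w \<Longrightarrow> v = w" for v w
    by (drule arg_cong[of _ _ ?I]) (simp only: IJ)
  have Ieq: "?I v = ?I w \<Longrightarrow> v = w" for v w
    by (drule arg_cong[of _ _ ?J]) (simp only: JI)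
  have linJ: "bounded_linear ?J" and linI: "bounded_linear ?I"
    unfolding linear_conv_bounded_linear[symmetric] by (auto simp: linear_iff vec_eq_iff)
  have bi: "bij (enum_of :: 'n \<Rightarrow> _)"
    by (metis bijI' enum_of_inject index_of_inverse UNIV_I)
  have [measurable]: "?J \<in> borel_measurable borel" "?I \<in> borel_measurable borel"
    by (intro borel_measurable_continuous_onI continuous_intros)+
  have J_image: "?J ` A = ?I -` A" for A
    by (rule set_eqI) (simp add: image_iff, metis IJ JI)
  have dist: "distr lborel borel ?I = lborel"
    by (rule lborel_distr_reindex[OF bi])
  have transfer: "(\<integral>\<^sup>+y\<in>A. h y \<partial>lborel) = (\<integral>\<^sup>+z\<in>?J ` A. h (?I z) \<partial>lborel)"
    if "(\<lambda>y. h y * indicator A y) \<in> borel_measurable borel" for A and h :: "real^'n \<Rightarrow> ennreal"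
  proof -
    have "(\<integral>\<^sup>+y\<in>A. h y \<partial>lborel) = (\<integral>\<^sup>+y\<in>A. h y \<partial>distr lborel borel ?I)"
      by (simp only: dist)
    also have "\<dots> = (\<integral>\<^sup>+z. h (?I z) * indicator A (?I z) \<partial>lborel)"
      using that by (intro nn_integral_distr) auto
    finally show ?thesis by (simp add: J_image indicator_vimage)
  qed
  let ?U = "\<lambda>z. ?J (T (?I z))" and ?U' = "\<lambda>z. ?J \<circ> T' (?I z) \<circ> ?I"
  have detU: "det (matrix (?U' z)) = det (matrix (T' (?I z)))" for z
  proof -
    have "matrix (?U' z) = (\<chi> i j. matrix (T' (?I z)) $ index_of i $ index_of j)"
    proof -
      have "?I (axis j 1) = axis (index_of j) 1" for j :: "'n enumerated"
        by (auto simp: vec_eq_iff axis_def enum_of_inverse index_of_inverse)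
      then show ?thesis by (simp add: matrix_def)
    qed
    then show ?thesis by (simp add: det_reindex[OF bij_index_of])
  qed
  have conv: "(\<lambda>y. ennreal (h y) * indicator A y) = (\<lambda>y. ennreal (indicator A y * h y))"
    for A and h :: "real^'n \<Rightarrow> real"
    by (auto simp: indicator_def)
  have UJ: "?U ` ?J ` S = ?J ` T ` S"
    by (simp only: image_image IJ)
  have "(\<integral>\<^sup>+y\<in>T ` S. ennreal (f y) \<partial>lborel) = (\<integral>\<^sup>+z\<in>?U ` ?J ` S. ennreal (f (?I z)) \<partial>lborel)"
    unfolding UJ by (rule transfer) (use fm in \<open>simp add: conv\<close>)
  also have "\<dots> = (\<integral>\<^sup>+z\<in>?J ` S. ennreal (\<bar>det (matrix (?U' z))\<bar> * f (?I (?U z))) \<partial>lborel)"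
  proof (rule nn_integral_change_of_variables_wellorder)
    show "?J ` S \<in> sets borel"
      unfolding J_image using S measurable_sets_borel[of ?I borel S] by simp
    show "inj_on ?U (?J ` S)"
    proof (rule inj_onI)
      fix z w assume z: "z \<in> ?J ` S" and w: "w \<in> ?J ` S" and "?U z = ?U w"
      then have "T (?I z) = T (?I w)" by (intro Jeq)
      moreover have "?I z \<in> S" "?I w \<in> S"
        using z w unfolding J_image by simp_all
      ultimately have "?I z = ?I w" using inj by (simp only: inj_on_eq_iff)
      then show "z = w" by (rule Ieq)
    qed
    show "(?U has_derivative ?U' z) (at z within ?J ` S)" if "z \<in> ?J ` S" for z
    proof -
      have "?I z \<in> S" using that unfolding J_image by simp
      then have "(?J \<circ> (T \<circ> ?I) has_derivative ?J \<circ> (T' (?I z) \<circ> ?I)) (at z)"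
        by (intro diff_chain_at bounded_linear_imp_has_derivative linI linJ der)
      then show ?thesis
        by (simp add: o_def has_derivative_at_withinI)
    qed
    show "(\<lambda>z. indicator (?U ` ?J ` S) z * f (?I z)) \<in> borel_measurable borel"
    proof -
      have "(\<lambda>z. indicator (T ` S) (?I z) * f (?I z)) \<in> borel_measurable borel"
        by (rule measurable_compose[OF _ fm]) simp
      then show ?thesis unfolding UJ by (simp add: J_image indicator_vimage)
    qed
    show "(\<lambda>z. indicator (?J ` S) z * (\<bar>det (matrix (?U' z))\<bar> * f (?I (?U z)))) \<in> borel_measurable borel"
    proof -
      have "(\<lambda>z. indicator S (?I z) * (\<bar>det (matrix (T' (?I z)))\<bar> * f (T (?I z)))) \<in> borel_measurable borel"
        by (rule measurable_compose[OF _ gm]) simp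
      then show ?thesis by (simp add: detU J_image indicator_vimage enum_of_inverse)
    qed
  qed (rule f0)
  also have "\<dots> = (\<integral>\<^sup>+z\<in>?J ` S. ennreal (\<bar>det (matrix (T' (?I z)))\<bar> * f (T (?I z))) \<partial>lborel)"
    by (simp only: detU IJ)
  also have "\<dots> = (\<integral>\<^sup>+x\<in>S. ennreal (\<bar>det (matrix (T' x))\<bar> * f (T x)) \<partial>lborel)"
    by (rule transfer[symmetric]) (use gm in \<open>simp add: conv\<close>)
  finally show ?thesis .
qed

section \<open>Gram determinants\<close>

text \<open>Along the segment from the identity matrix to \<open>J\<^sup>T J\<close> all matrices are positive definite, hence
  invertible. The determinant thus has no zero on the segment, and it is \<open>1\<close> at the identity.\<close>

lemma det_gram_pos:
  fixes J :: "real^'n^'m"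
  assumes inj: "inj ((*v) J)"
  shows "0 < det (transpose J ** J)"
proof (rule ccontr)
  define G where "G s = s *\<^sub>R (transpose J ** J) + (1 - s) *\<^sub>R mat 1" for s :: real
  have "continuous_on {0..1} (\<lambda>s. det (G s))"
    unfolding det_def G_def by (simp, intro continuous_intros)
  moreover assume "\<not> 0 < det (transpose J ** J)"
  ultimately obtain s where s: "0 \<le> s" "s \<le> 1" "det (G s) = 0"
    using IVT2'[of "\<lambda>s. det (G s)" 1 0 0] by (auto simp: G_def)
  have "x = 0" if "G s *v x = 0" for x
  proof -
    have "0 = x \<bullet> (G s *v x)" using that by simp
    also have "\<dots> = s * (x \<bullet> (transpose J *v (J *v x))) + (1 - s) * (x \<bullet> x)"
      by (simp add: G_def matrix_vector_mult_add_rdistrib scaleR_matrix_vector_assoc[symmetric]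
          inner_add_right matrix_vector_mul_assoc del: transpose_matrix_vector)
    also have "x \<bullet> (transpose J *v (J *v x)) = (J *v x) \<bullet> (J *v x)"
      by (metis dot_lmul_matrix inner_commute transpose_matrix_vector)
    finally have "s * ((J *v x) \<bullet> (J *v x)) + (1 - s) * (x \<bullet> x) = 0" by simp
    moreover have "0 \<le> s * ((J *v x) \<bullet> (J *v x))" "0 \<le> (1 - s) * (x \<bullet> x)"
      using s by simp_all
    ultimately have "s * ((J *v x) \<bullet> (J *v x)) = 0" "(1 - s) * (x \<bullet> x) = 0"
      by linarith+
    then have "J *v x = 0 \<or> x = 0" by (cases "s = 0") simp_all
    then show "x = 0"
      using injD[OF inj, of x 0] by auto
  qed
  then have "invertible (G s)"
    by (simp add: invertible_left_inverse matrix_left_invertible_ker)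
  then show False
    using s(3) by (simp add: invertible_det_nz)
qed

section \<open>Charts, tangent vectors and the pullback metric in coordinates\<close>

lemma is_chartD:
  assumes "is_chart c"
  shows "open (fst c)" "open (snd c ` fst c)"
    "\<And>x. x \<in> fst c \<Longrightarrow> chart_inv c (snd c x) = x"
    "\<And>u. u \<in> snd c ` fst c \<Longrightarrow> snd c (chart_inv c u) = u"
    "\<And>u. u \<in> snd c ` fst c \<Longrightarrow> chart_inv c u \<in> fst c"
    "inj_on (snd c) (fst c)"
    "continuous_on (fst c) (snd c)" "continuous_on (snd c ` fst c) (chart_inv c)"
  using assms by (auto simp: is_chart_def homeomorphism_def intro: inj_on_inverseI)

lemma open_chart_image:
  assumes "is_chart c" "open B" "B \<subseteq> fst c"
  shows "open (snd c ` B)"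
proof -
  have "homeomorphism (fst c) (snd c ` fst c) (snd c) (chart_inv c)"
    using assms by (simp add: is_chart_def)
  then have "openin (top_of_set (snd c ` fst c)) (snd c ` B)"
    by (rule homeomorphism_imp_open_map) (use assms in \<open>simp add: open_subset\<close>)
  then show ?thesis
    using is_chartD(2)[OF assms(1)] by (simp add: openin_open_eq)
qed

lemma open_chart_inv_image:
  assumes "is_chart c" "open V" "V \<subseteq> snd c ` fst c"
  shows "open (chart_inv c ` V)"
proof -
  have "homeomorphism (snd c ` fst c) (fst c) (chart_inv c) (snd c)"
    using assms by (simp add: is_chart_def homeomorphism_symD)
  then have "openin (top_of_set (fst c)) (chart_inv c ` V)"
    by (rule homeomorphism_imp_open_map) (use assms in \<open>simp add: open_subset\<close>)
  then show ?thesis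
    using is_chartD(1)[OF assms(1)] by (simp add: openin_open_eq)
qed

lemma smooth_atlasD:
  assumes "smooth_atlas A"
  shows "c \<in> A \<Longrightarrow> is_chart c" "\<exists>c. c \<in> charts_at A x"
proof -
  have "x \<in> (\<Union>c\<in>A. fst c)" using assms by (simp add: smooth_atlas_def)
  then show "\<exists>c. c \<in> charts_at A x" unfolding charts_at_def by blast
qed (use assms in \<open>simp add: smooth_atlas_def\<close>)

lemma charts_atD:
  assumes "c \<in> charts_at A x"
  shows "c \<in> A" "x \<in> fst c"
  using assms by (auto simp: charts_at_def)

lemma charts_atI: "c \<in> A \<Longrightarrow> x \<in> fst c \<Longrightarrow> c \<in> charts_at A x"
  by (simp add: charts_at_def)

lemma transition_has_derivative:
  assumes A: "smooth_atlas A" and c: "c \<in> charts_at A x" "c' \<in> charts_at A x"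
  shows "(snd c' \<circ> chart_inv c has_derivative transition_diff x c c') (at (snd c x))"
proof -
  have "Ck_on (Suc 0) (snd c ` (fst c \<inter> fst c')) (snd c' \<circ> chart_inv c)"
    using A charts_atD(1)[OF c(1)] charts_atD(1)[OF c(2)]
    by (simp add: smooth_atlas_def del: Ck_on.simps)
  then have "(snd c' \<circ> chart_inv c) differentiable (at (snd c x))"
    using charts_atD[OF c(1)] charts_atD[OF c(2)] by simp
  then show ?thesis
    by (simp add: transition_diff_def frechet_derivative_works)
qed

text \<open>Chain rule on the overlap of two charts. With \<open>G = snd c''\<close> it gives the cocycle identity of
  the transition differentials, and with an embedding \<open>G\<close> the transformation rule of its Jacobian.\<close>

lemma has_derivative_change_chart:
  fixes G :: "'m::topological_space \<Rightarrow> 'b::real_normed_vector"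
  assumes A: "smooth_atlas A" and c: "c \<in> charts_at A x" "c' \<in> charts_at A x"
    and G: "(G \<circ> chart_inv c' has_derivative D) (at (snd c' x))"
  shows "(G \<circ> chart_inv c has_derivative D \<circ> transition_diff x c c') (at (snd c x))"
proof -
  note ch = smooth_atlasD(1)[OF A charts_atD(1)[OF c(1)]] smooth_atlasD(1)[OF A charts_atD(1)[OF c(2)]]
  note x = charts_atD(2)[OF c(1)] charts_atD(2)[OF c(2)]
  have "((G \<circ> chart_inv c') \<circ> (snd c' \<circ> chart_inv c) has_derivative D \<circ> transition_diff x c c')
      (at (snd c x))"
    by (intro diff_chain_at transition_has_derivative[OF A c])
       (use G is_chartD(3)[OF ch(1) x(1)] in simp)
  then show ?thesis
  proof (rule has_derivative_transform_within_open)
    show "open (snd c ` (fst c \<inter> fst c'))"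
      using is_chartD(1)[OF ch(1)] is_chartD(1)[OF ch(2)] by (intro open_chart_image ch) auto
    show "snd c x \<in> snd c ` (fst c \<inter> fst c')" using x by simp
  qed (use is_chartD(3)[OF ch(1)] is_chartD(3)[OF ch(2)] in auto)
qed

lemma transition_diff_refl:
  assumes A: "smooth_atlas A" and c: "c \<in> charts_at A x"
  shows "transition_diff x c c = id"
proof -
  note ch = smooth_atlasD(1)[OF A charts_atD(1)[OF c]]
  have "(snd c \<circ> chart_inv c has_derivative id) (at (snd c x))"
    by (rule has_derivative_transform_within_open[OF has_derivative_id is_chartD(2)[OF ch]])
       (use charts_atD(2)[OF c] is_chartD(4)[OF ch] in auto)
  then show ?thesis
    unfolding transition_diff_def by (rule frechet_derivative_at[symmetric])
qed

lemma transition_diff_trans: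
  assumes A: "smooth_atlas A"
    and c: "c \<in> charts_at A x" "c' \<in> charts_at A x" "c'' \<in> charts_at A x"
  shows "transition_diff x c c'' = transition_diff x c' c'' \<circ> transition_diff x c c'"
  using has_derivative_change_chart[OF A c(1,2) transition_has_derivative[OF A c(2,3)]]
  unfolding transition_diff_def[of x c c''] by (rule frechet_derivative_at[symmetric])

text \<open>This is the cocycle identity: the family that defines a coordinate vector is compatible
  with all transition maps.\<close>

lemma coord_vector_in_tangent_space:
  assumes A: "smooth_atlas A" and c: "c \<in> charts_at A x"
  shows "coord_vector A c x u \<in> tangent_space A x"
  unfolding tangent_space_def mem_Collect_eq
proof (intro conjI allI impI ballI)
  show "coord_vector A c x u c' = 0" if "c' \<notin> charts_at A x" for c'
    using that by (simp add: coord_vector_def)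
  have repr: "coord_vector A c x u c' = transition_diff x c c' u" if "c' \<in> charts_at A x" for c'
    using that by (simp add: coord_vector_def)
  show "coord_vector A c x u c'' = transition_diff x c' c'' (coord_vector A c x u c')"
    if "c' \<in> charts_at A x" "c'' \<in> charts_at A x" for c' c''
    unfolding repr[OF that(1)] repr[OF that(2)]
    using fun_cong[OF transition_diff_trans[OF A c that], of u] unfolding comp_apply .
qed

lemma coord_vector_self:
  assumes A: "smooth_atlas A" and c: "c \<in> charts_at A x"
  shows "coord_vector A c x u c = u"
  using transition_diff_refl[OF A c] c by (simp add: coord_vector_def)

lemma Ck_map_has_derivative:
  assumes F: "Ck_map (Suc k) A F" and c: "c \<in> charts_at A x"
  shows "(F \<circ> chart_inv c has_derivative frechet_derivative (F \<circ> chart_inv c) (at (snd c x)))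
    (at (snd c x))"
proof -
  have "Ck_on (Suc k) (snd c ` fst c) (F \<circ> chart_inv c)"
    using F charts_atD(1)[OF c] by (simp add: Ck_map_def del: Ck_on.simps)
  then show ?thesis
    using charts_atD(2)[OF c] by (simp add: frechet_derivative_works)
qed

lemma frechet_derivative_change_chart:
  assumes A: "smooth_atlas A" and F: "Ck_map (Suc k) A F"
    and c: "c \<in> charts_at A x" "c' \<in> charts_at A x"
  shows "frechet_derivative (F \<circ> chart_inv c) (at (snd c x)) =
    frechet_derivative (F \<circ> chart_inv c') (at (snd c' x)) \<circ> transition_diff x c c'"
  using has_derivative_change_chart[OF A c Ck_map_has_derivative[OF F c(2)]]
  by (rule frechet_derivative_at[symmetric])

lemma differential_coord_vector:
  assumes A: "smooth_atlas A" and F: "Ck_map (Suc k) A F" and c: "c \<in> charts_at A x"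
  shows "differential A F x (coord_vector A c x u) =
    frechet_derivative (F \<circ> chart_inv c) (at (snd c x)) u"
proof -
  define c' where "c' = (SOME c. c \<in> charts_at A x)"
  have c': "c' \<in> charts_at A x" unfolding c'_def using c by (rule someI)
  show ?thesis
    unfolding differential_def Let_def c'_def[symmetric] frechet_derivative_change_chart[OF A F c c']
    using c' by (simp add: coord_vector_def)
qed

text \<open>In a chart the matrix of the induced metric is the Gram matrix of the Jacobian of the
  embedding. Positivity of its determinant and its transformation by \<open>(det T)\<^sup>2\<close> follow.\<close>

lemma metric_matrix_pullback:
  fixes A :: "('m::topological_space, real^'d) chart set" and F :: "'m \<Rightarrow> real^'n"
  assumes A: "smooth_atlas A" and F: "Ck_map (Suc k) A F" and c: "c \<in> charts_at A x"
  defines "J \<equiv> matrix (frechet_derivative (F \<circ> chart_inv c) (at (snd c x)))"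
  shows "metric_matrix A (pullback_metric A F) c x = transpose J ** J"
proof -
  have col: "frechet_derivative (F \<circ> chart_inv c) (at (snd c x)) (axis i 1) = (\<chi> k. J $ k $ i)" for i
    by (simp add: J_def matrix_def)
  show ?thesis
    by (simp add: metric_matrix_def pullback_metric_def differential_coord_vector[OF A F c] col
        matrix_matrix_mult_def transpose_def inner_vec_def)
qed

text \<open>An embedding is immersive, so its Jacobian in a chart is injective: coordinate vectors are
  tangent vectors, and they are determined by their components.\<close>

lemma det_metric_matrix_pos:
  fixes A :: "('m::topological_space, real^'d) chart set" and F :: "'m \<Rightarrow> real^'n"
  assumes A: "smooth_atlas A" and F: "Ck_embedding (Suc k) A F" and c: "c \<in> charts_at A x"
  shows "0 < det (metric_matrix A (pullback_metric A F) c x)"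
proof -
  let ?D = "frechet_derivative (F \<circ> chart_inv c) (at (snd c x))"
  have F': "Ck_map (Suc k) A F" and inj: "inj_on (differential A F x) (tangent_space A x)"
    using F by (auto simp: Ck_embedding_def)
  have "inj ?D"
  proof (rule injI)
    fix u v assume "?D u = ?D v"
    then have "differential A F x (coord_vector A c x u) = differential A F x (coord_vector A c x v)"
      by (simp add: differential_coord_vector[OF A F' c])
    then have "coord_vector A c x u = coord_vector A c x v"
      using inj coord_vector_in_tangent_space[OF A c] by (simp add: inj_on_eq_iff)
    then show "u = v"
      using coord_vector_self[OF A c] by metis
  qed
  moreover have "(*v) (matrix ?D) = ?D"
    using Ck_map_has_derivative[OF F' c] by (intro matrix_vector_mul(2) has_derivative_linear)
  ultimately show ?thesis
    by (simp add: metric_matrix_pullback[OF A F' c] det_gram_pos)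
qed

lemma det_metric_matrix_change_chart:
  fixes A :: "('m::topological_space, real^'d) chart set" and F :: "'m \<Rightarrow> real^'n"
  assumes A: "smooth_atlas A" and F: "Ck_map (Suc k) A F"
    and c: "c \<in> charts_at A x" "c' \<in> charts_at A x"
  shows "det (metric_matrix A (pullback_metric A F) c x) =
    (det (matrix (transition_diff x c c')))\<^sup>2 * det (metric_matrix A (pullback_metric A F) c' x)"
proof -
  let ?J = "matrix (frechet_derivative (F \<circ> chart_inv c) (at (snd c x)))"
    and ?J' = "matrix (frechet_derivative (F \<circ> chart_inv c') (at (snd c' x)))"
    and ?T = "matrix (transition_diff x c c')"
  have "?J = ?J' ** ?T"
    unfolding frechet_derivative_change_chart[OF A F c]
    by (intro matrix_compose has_derivative_linear)
       (rule transition_has_derivative[OF A c] Ck_map_has_derivative[OF F c(2)])+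
  then have "transpose ?J ** ?J = transpose ?T ** (transpose ?J' ** ?J') ** ?T"
    by (simp add: matrix_transpose_mul matrix_mul_assoc)
  then show ?thesis
    by (simp add: metric_matrix_pullback[OF A F c(1)] metric_matrix_pullback[OF A F c(2)]
        det_mul det_transpose power2_eq_square)
qed

text \<open>The entries of the matrix are inner products of first partial derivatives, which are
  differentiable because \<open>F\<close> is of class $C^2$.\<close>

lemma continuous_on_det_metric_matrix:
  fixes A :: "('m::topological_space, real^'d) chart set" and F :: "'m \<Rightarrow> real^'n"
  assumes A: "smooth_atlas A" and F: "Ck_map 2 A F" and c: "c \<in> A"
  shows "continuous_on (snd c ` fst c)
    (\<lambda>u. det (metric_matrix A (pullback_metric A F) c (chart_inv c u)))"
proof -
  note ch = smooth_atlasD(1)[OF A c]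
  let ?D = "\<lambda>u. frechet_derivative (F \<circ> chart_inv c) (at u)"
  have "Ck_on (Suc (Suc 0)) (snd c ` fst c) (F \<circ> chart_inv c)"
    using F c by (simp add: Ck_map_def numeral_2_eq_2 del: Ck_on.simps)
  then have "(\<lambda>u. ?D u v) differentiable (at u)" if "u \<in> snd c ` fst c" for u v
    using that by auto
  then have D: "continuous_on (snd c ` fst c) (\<lambda>u. ?D u v)" for v
    by (meson continuous_at_imp_continuous_on differentiable_imp_continuous_within)
  have "continuous_on (snd c ` fst c)
      (\<lambda>u. det (\<chi> i j. ?D u (axis i 1) \<bullet> ?D u (axis j 1)))"
    unfolding det_def by (simp, intro continuous_intros D)
  moreover have "metric_matrix A (pullback_metric A F) c (chart_inv c u) =
      (\<chi> i j. ?D u (axis i 1) \<bullet> ?D u (axis j 1))" if "u \<in> snd c ` fst c" for u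
  proof -
    have cx: "c \<in> charts_at A (chart_inv c u)"
      using c is_chartD(5)[OF ch that] by (simp add: charts_atI)
    have F': "Ck_map (Suc 1) A F" using F by (simp add: numeral_2_eq_2)
    show ?thesis
      by (simp add: metric_matrix_def pullback_metric_def differential_coord_vector[OF A F' cx]
          is_chartD(4)[OF ch that])
  qed
  ultimately show ?thesis by (simp cong: continuous_on_cong)
qed

section \<open>Gluing chart densities to a measure\<close>

text \<open>Any family of continuous positive functions on the chart images that transforms by the absolute
  value of the Jacobian determinant is glued to a unique Borel measure. The Riemannian density is
  the family to which this is applied.\<close>

locale chart_density =
  fixes A :: "('m::second_countable_topology, real^'d) chart set"
    and \<rho> :: "('m, real^'d) chart \<Rightarrow> real^'d \<Rightarrow> real"
  assumes atlas: "smooth_atlas A"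
    and density_continuous: "c \<in> A \<Longrightarrow> continuous_on (snd c ` fst c) (\<rho> c)"
    and density_pos: "c \<in> A \<Longrightarrow> x \<in> fst c \<Longrightarrow> 0 < \<rho> c (snd c x)"
    and density_transform: "c \<in> charts_at A x \<Longrightarrow> c' \<in> charts_at A x \<Longrightarrow>
      \<rho> c (snd c x) = \<bar>det (matrix (transition_diff x c c'))\<bar> * \<rho> c' (snd c' x)"
begin

definition chart_volume :: "('m, real^'d) chart \<Rightarrow> 'm set \<Rightarrow> ennreal" where
  "chart_volume c B = (\<integral>\<^sup>+u\<in>snd c ` B. ennreal (\<rho> c u) \<partial>lborel)"

definition is_volume :: "'m measure \<Rightarrow> bool" where
  "is_volume \<mu> \<longleftrightarrow> sets \<mu> = sets borel \<and>
     (\<forall>c\<in>A. \<forall>B\<in>sets borel. B \<subseteq> fst c \<longrightarrow> emeasure \<mu> B = chart_volume c B)"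

lemma chart: "c \<in> A \<Longrightarrow> is_chart c"
  using smooth_atlasD(1)[OF atlas] .

lemma chart_domain_borel: "c \<in> A \<Longrightarrow> fst c \<in> sets borel"
  using is_chartD(1)[OF chart] by simp

lemma chart_image_borel:
  assumes c: "c \<in> A" and B: "B \<in> sets borel" "B \<subseteq> fst c"
  shows "snd c ` B \<in> sets borel"
proof -
  note ch = chart[OF c]
  \<comment> \<open>The image of \<open>B\<close> is a preimage under this total measurable extension of the inverse chart.\<close>
  define h where "h u = (if u \<in> snd c ` fst c then chart_inv c u else undefined)" for u
  have U: "snd c ` fst c \<in> sets borel"
    using is_chartD(2)[OF ch] by simp
  then have "h \<in> borel_measurable borel"
    unfolding h_def by (intro borel_measurable_continuous_on_if is_chartD(8)[OF ch]) auto
  then have "h -` B \<inter> snd c ` fst c \<in> sets borel"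
    using measurable_sets_borel[of h borel B] B U by (intro sets.Int) auto
  moreover have "h -` B \<inter> snd c ` fst c = snd c ` B"
  proof (intro set_eqI iffI)
    fix u assume "u \<in> h -` B \<inter> snd c ` fst c"
    then have "u = snd c (chart_inv c u)" "chart_inv c u \<in> B"
      using is_chartD(4)[OF ch] by (auto simp: h_def)
    then show "u \<in> snd c ` B" by blast
  next
    fix u assume "u \<in> snd c ` B"
    then obtain x where x: "x \<in> B" "u = snd c x" by blast
    moreover have "x \<in> fst c" using x B(2) by blast
    ultimately show "u \<in> h -` B \<inter> snd c ` fst c"
      using is_chartD(3)[OF ch] by (simp add: h_def)
  qed
  ultimately show ?thesis by simp
qed

lemma density_indicator_measurable:
  assumes c: "c \<in> A" and B: "B \<in> sets borel" "B \<subseteq> fst c"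
  shows "(\<lambda>u. indicator (snd c ` B) u * \<rho> c u) \<in> borel_measurable borel"
proof -
  have "continuous_on (snd c ` B) (\<rho> c)"
    using B(2) by (intro continuous_on_subset[OF density_continuous[OF c]] image_mono)
  then have "(\<lambda>u. indicator (snd c ` B) u *\<^sub>R \<rho> c u) \<in> borel_measurable borel"
    by (rule borel_measurable_continuous_on_indicator[OF chart_image_borel[OF assms]])
  then show ?thesis by simp
qed

text \<open>On the image of a chart, \<open>chart_volume\<close> is a density measure with respect to Lebesgue measure;
  the injective chart keeps disjoint sets disjoint.\<close>

lemma chart_volume_UN:
  fixes B :: "nat \<Rightarrow> 'm set"
  assumes c: "c \<in> A" and B: "\<And>i. B i \<in> sets borel" "\<And>i. B i \<subseteq> fst c"
    and disj: "disjoint_family B"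
  shows "chart_volume c (\<Union>i. B i) = (\<Sum>i. chart_volume c (B i))"
proof -
  let ?N = "density lborel (\<lambda>u. ennreal (indicator (snd c ` fst c) u * \<rho> c u))"
  have eq: "chart_volume c E = emeasure ?N (snd c ` E)" if "E \<in> sets borel" "E \<subseteq> fst c" for E
  proof -
    have "emeasure ?N (snd c ` E) =
        (\<integral>\<^sup>+u. ennreal (indicator (snd c ` fst c) u * \<rho> c u) * indicator (snd c ` E) u \<partial>lborel)"
      by (intro emeasure_density)
         (use density_indicator_measurable[OF c chart_domain_borel[OF c]] chart_image_borel[OF c that]
          in auto)
    also have "\<dots> = chart_volume c E"
      unfolding chart_volume_def using that(2)
      by (intro nn_integral_cong) (auto simp: indicator_def)
    finally show ?thesis ..
  qed
  have "(\<Sum>i. emeasure ?N (snd c ` B i)) = emeasure ?N (\<Union>i. snd c ` B i)"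
  proof (rule suminf_emeasure)
    show "range (\<lambda>i. snd c ` B i) \<subseteq> sets ?N"
      using chart_image_borel[OF c B] by auto
    show "disjoint_family (\<lambda>i. snd c ` B i)"
      using disj B(2) is_chartD(6)[OF chart[OF c]]
      unfolding disjoint_family_on_def by (metis image_empty inj_on_image_Int)
  qed
  moreover have "(\<Union>i. B i) \<in> sets borel" "(\<Union>i. B i) \<subseteq> fst c"
    using B by auto
  ultimately show ?thesis
    by (simp add: eq B image_UN)
qed

text \<open>By the transformation rule, the integrand that the change of variables formula produces for the
  transition map is the density of the other chart.\<close>

lemma chart_volume_change_chart:
  assumes c: "c \<in> A" and c': "c' \<in> A" and B: "B \<in> sets borel" "B \<subseteq> fst c" "B \<subseteq> fst c'"
  shows "chart_volume c B = chart_volume c' B"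
proof -
  note ch = chart[OF c] and ch' = chart[OF c']
  let ?T = "snd c' \<circ> chart_inv c" and ?T' = "\<lambda>u. transition_diff (chart_inv c u) c c'"
  \<comment> \<open>Cut off outside the chart image, where \<open>\<rho> c'\<close> need not be nonnegative.\<close>
  let ?f = "\<lambda>u. indicator (snd c' ` fst c') u * \<rho> c' u"
  have at: "c \<in> charts_at A x" "c' \<in> charts_at A x" if "x \<in> B" for x
    using that B c c' by (auto simp: charts_at_def)
  have inv: "chart_inv c (snd c x) = x" if "x \<in> B" for x
    using that B is_chartD(3)[OF ch] by auto
  have im: "?T ` snd c ` B = snd c' ` B"
    using inv by (auto simp: image_image)
  have pull: "\<bar>det (matrix (?T' u))\<bar> * ?f (?T u) = \<rho> c u" if "u \<in> snd c ` B" for u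
    using that B density_transform[OF at] by (auto simp: inv)
  have f_ind: "indicator (snd c' ` B) u * ?f u = indicator (snd c' ` B) u * \<rho> c' u" for u
    using B by (auto simp: indicator_def)
  have "chart_volume c' B = (\<integral>\<^sup>+u\<in>?T ` snd c ` B. ennreal (?f u) \<partial>lborel)"
    unfolding chart_volume_def im using B
    by (intro nn_integral_cong) (auto simp: indicator_def)
  also have "\<dots> = (\<integral>\<^sup>+u\<in>snd c ` B. ennreal (\<bar>det (matrix (?T' u))\<bar> * ?f (?T u)) \<partial>lborel)"
  proof (rule nn_integral_change_of_variables)
    show "snd c ` B \<in> sets borel"
      using c B by (intro chart_image_borel)
    show "(?T has_derivative ?T' u) (at u)" if "u \<in> snd c ` B" for u
      using that transition_has_derivative[OF atlas at] by (auto simp: inv)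
    show "inj_on ?T (snd c ` B)"
      using inj_on_subset[OF is_chartD(6)[OF ch'] B(3)] by (auto simp: inj_on_def inv)
    show "0 \<le> ?f u" for u
      using density_pos[OF c'] by (auto simp: indicator_def less_imp_le)
    show "(\<lambda>u. indicator (?T ` snd c ` B) u * ?f u) \<in> borel_measurable borel"
      unfolding im f_ind using c' B by (intro density_indicator_measurable)
    have "(\<lambda>u. indicator (snd c ` B) u * (\<bar>det (matrix (?T' u))\<bar> * ?f (?T u))) =
        (\<lambda>u. indicator (snd c ` B) u * \<rho> c u)"
      using pull by (auto simp: indicator_def fun_eq_iff simp del: comp_apply)
    then show "(\<lambda>u. indicator (snd c ` B) u * (\<bar>det (matrix (?T' u))\<bar> * ?f (?T u)))
        \<in> borel_measurable borel"
      using density_indicator_measurable[OF c B(1,2)] by simp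
  qed
  also have "\<dots> = chart_volume c B"
    unfolding chart_volume_def using pull
    by (intro nn_integral_cong) (auto simp: indicator_def simp del: comp_apply)
  finally show ?thesis ..
qed

definition chart_partition :: "(nat \<Rightarrow> ('m, real^'d) chart) \<Rightarrow> (nat \<Rightarrow> 'm set) \<Rightarrow> bool" where
  "chart_partition c D \<longleftrightarrow> (\<forall>n. c n \<in> A \<and> D n \<in> sets borel \<and> D n \<subseteq> fst (c n)) \<and>
     disjoint_family D \<and> (\<Union>n. D n) = UNIV"

text \<open>By the Lindeloef property countably many chart domains cover the manifold; making them disjoint
  keeps each piece inside one chart.\<close>

lemma chart_partition_exists: "\<exists>c D. chart_partition c D"
proof -
  obtain \<F> where \<F>: "\<F> \<subseteq> fst ` A" "countable \<F>" "\<Union>\<F> = \<Union>(fst ` A)"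
  proof (rule Lindelof)
    show "open S" if "S \<in> fst ` A" for S
      using that is_chartD(1)[OF chart] by auto
  qed
  have cover: "\<Union>\<F> = UNIV"
    using \<F>(3) atlas by (simp add: smooth_atlas_def)
  then have ne: "\<F> \<noteq> {}" by auto
  define U where "U = from_nat_into \<F>"
  have U_A: "U n \<in> fst ` A" for n
    using from_nat_into[OF ne] \<F>(1) unfolding U_def by blast
  have U_cover: "(\<Union>n. U n) = UNIV"
    using cover range_from_nat_into[OF ne \<F>(2)] by (simp add: U_def)
  define c where "c n = (SOME c. c \<in> A \<and> fst c = U n)" for n
  have c: "c n \<in> A \<and> fst (c n) = U n" for n
    unfolding c_def by (rule someI_ex) (use U_A[of n] in auto)
  have "range U \<subseteq> sets borel"
    using c chart_domain_borel by (metis image_subsetI)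
  then have "disjointed U n \<in> sets borel" for n
    using sets.range_disjointed_sets[of U borel] by auto
  moreover have "disjointed U n \<subseteq> fst (c n)" for n
    using c disjointed_subset[of U n] by simp
  ultimately show ?thesis
    using c disjoint_family_disjointed[of U] UN_disjointed_eq[of U] U_cover
    unfolding chart_partition_def by (intro exI[of _ c] exI[of _ "disjointed U"]) auto
qed

text \<open>The measure of \<open>B\<close> is the sum of the volumes of the pieces of \<open>B\<close>, each taken in the chart that
  the partition assigns to it. Independence of the chart shows that it has the prescribed density
  in all other charts as well.\<close>

lemma volume_exists: "\<exists>\<mu>. is_volume \<mu>"
proof -
  obtain c D where cD: "chart_partition c D"
    using chart_partition_exists by blast
  then have c: "c n \<in> A" and D: "D n \<in> sets borel" "D n \<subseteq> fst (c n)" for n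
    by (auto simp: chart_partition_def)
  have D_UN: "disjoint_family D" "(\<Union>n. D n) = UNIV"
    using cD by (auto simp: chart_partition_def)
  define m where "m B = (\<Sum>n. chart_volume (c n) (B \<inter> D n))" for B
  define \<mu> where "\<mu> = measure_of UNIV (sets borel) m"
  have "countably_additive (sets borel) m"
    unfolding countably_additive_def
  proof (intro allI impI)
    fix B :: "nat \<Rightarrow> 'm set"
    assume B: "range B \<subseteq> sets borel" "disjoint_family B"
    \<comment> \<open>The sum over pieces is read as an integral over the counting measure, to interchange two series.\<close>
    have "(\<Sum>i. m (B i)) = (\<Sum>i. \<integral>\<^sup>+n. chart_volume (c n) (B i \<inter> D n) \<partial>count_space UNIV)"
      by (simp add: m_def nn_integral_count_space_nat)
    also have "\<dots> = (\<integral>\<^sup>+n. (\<Sum>i. chart_volume (c n) (B i \<inter> D n)) \<partial>count_space UNIV)"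
      by (rule nn_integral_suminf[symmetric]) simp
    also have "\<dots> = (\<integral>\<^sup>+n. chart_volume (c n) (\<Union>i. B i \<inter> D n) \<partial>count_space UNIV)"
    proof (rule nn_integral_cong)
      fix n
      show "(\<Sum>i. chart_volume (c n) (B i \<inter> D n)) = chart_volume (c n) (\<Union>i. B i \<inter> D n)"
        by (rule chart_volume_UN[symmetric])
           (use c D B in \<open>auto intro: disjoint_family_subset[OF B(2)]\<close>)
    qed
    also have "\<dots> = m (\<Union>(range B))"
      by (simp add: m_def nn_integral_count_space_nat)
    finally show "(\<Sum>i. m (B i)) = m (\<Union>(range B))" .
  qed
  moreover have "positive (sets borel) m"
    by (simp add: positive_def m_def chart_volume_def)
  moreover have "sigma_algebra UNIV (sets (borel :: 'm measure))"
    using sets.sigma_algebra_axioms[of borel] by simp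
  ultimately have emeasure_\<mu>: "emeasure \<mu> B = m B" if "B \<in> sets borel" for B
    unfolding \<mu>_def using that by (intro emeasure_measure_of_sigma)
  have "emeasure \<mu> B = chart_volume k B" if k: "k \<in> A" and B: "B \<in> sets borel" "B \<subseteq> fst k" for k B
  proof -
    have "m B = (\<Sum>n. chart_volume k (B \<inter> D n))"
      unfolding m_def by (rule suminf_cong, rule chart_volume_change_chart) (use c k B D in \<open>auto dest: subsetD[OF D(2)]\<close>)
    also have "\<dots> = chart_volume k (\<Union>n. B \<inter> D n)"
      by (rule chart_volume_UN[symmetric]) (use k D B in \<open>auto intro: disjoint_family_subset[OF D_UN(1)]\<close>)
    also have "(\<Union>n. B \<inter> D n) = B"
      using D_UN(2) by (metis Int_UN_distrib inf_top_right)
    finally show ?thesis using emeasure_\<mu>[OF B(1)] by simp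
  qed
  moreover have "sets \<mu> = sets borel"
    unfolding \<mu>_def by (metis sets.sets_measure_of_eq space_borel)
  ultimately show ?thesis by (auto simp: is_volume_def)
qed

lemma volume_unique:
  assumes "is_volume \<mu>" "is_volume \<nu>"
  shows "\<mu> = \<nu>"
proof (rule measure_eqI)
  show "sets \<mu> = sets \<nu>" using assms by (simp add: is_volume_def)
  obtain c D where cD: "chart_partition c D"
    using chart_partition_exists by blast
  then have c: "c n \<in> A" and D: "D n \<in> sets borel" "D n \<subseteq> fst (c n)" for n
    by (auto simp: chart_partition_def)
  have D_UN: "disjoint_family D" "(\<Union>n. D n) = UNIV"
    using cD by (auto simp: chart_partition_def)
  have split: "emeasure \<kappa> B = (\<Sum>n. chart_volume (c n) (B \<inter> D n))"
    if \<kappa>: "is_volume \<kappa>" and B: "B \<in> sets borel" for \<kappa> B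
  proof -
    have "emeasure \<kappa> B = emeasure \<kappa> (\<Union>n. B \<inter> D n)"
      using D_UN(2) by (metis Int_UN_distrib inf_top_right)
    also have "\<dots> = (\<Sum>n. emeasure \<kappa> (B \<inter> D n))"
      by (rule suminf_emeasure[symmetric])
         (use \<kappa> B D in \<open>auto simp: is_volume_def intro: disjoint_family_subset[OF D_UN(1)]\<close>)
    also have "\<dots> = (\<Sum>n. chart_volume (c n) (B \<inter> D n))"
      using \<kappa> B D c by (intro suminf_cong) (simp add: is_volume_def le_infI2)
    finally show ?thesis .
  qed
  fix B assume "B \<in> sets \<mu>"
  then have "B \<in> sets borel" using assms by (simp add: is_volume_def)
  then show "emeasure \<mu> B = emeasure \<nu> B"
    using assms by (simp add: split)
qed

context
  fixes \<mu> assumes vol: "is_volume \<mu>"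
begin

lemma sets_volume: "sets \<mu> = sets borel"
  using vol by (simp add: is_volume_def)

lemma emeasure_volume:
  "c \<in> A \<Longrightarrow> B \<in> sets borel \<Longrightarrow> B \<subseteq> fst c \<Longrightarrow> emeasure \<mu> B = chart_volume c B"
  using vol by (simp add: is_volume_def)

text \<open>A positive density integrates to zero over an open set only if the set is negligible, and
  a nonempty open set is not.\<close>

lemma volume_open_pos:
  assumes W: "open W" "W \<noteq> {}"
  shows "emeasure \<mu> W \<noteq> 0"
proof
  assume null: "emeasure \<mu> W = 0"
  obtain x where x: "x \<in> W" using W by auto
  obtain c where c: "c \<in> charts_at A x" using smooth_atlasD(2)[OF atlas] by blast
  note cA = charts_atD[OF c] and ch = chart[OF charts_atD(1)[OF c]]
  let ?B = "W \<inter> fst c"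
  have B: "open ?B" using W is_chartD(1)[OF ch] by (intro open_Int)
  then have "emeasure \<mu> ?B \<le> emeasure \<mu> W"
    using W by (intro emeasure_mono) (auto simp: sets_volume)
  then have "chart_volume c ?B = 0"
    using emeasure_volume[OF cA(1), of ?B] B null by simp
  moreover have "(\<lambda>u. ennreal (\<rho> c u) * indicator (snd c ` ?B) u) =
      (\<lambda>u. ennreal (indicator (snd c ` ?B) u * \<rho> c u))"
    by (auto simp: indicator_def)
  ultimately have "AE u in lborel. ennreal (indicator (snd c ` ?B) u * \<rho> c u) = 0"
    using density_indicator_measurable[OF cA(1), of ?B] B
    by (simp add: chart_volume_def nn_integral_0_iff_AE)
  moreover have "u \<notin> snd c ` ?B" if "ennreal (indicator (snd c ` ?B) u * \<rho> c u) = 0" for u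
  proof
    assume u: "u \<in> snd c ` ?B"
    then have "0 < \<rho> c u" using density_pos[OF cA(1)] by blast
    then show False using u that by (simp add: ennreal_eq_0_iff)
  qed
  ultimately have "AE u in lborel. u \<notin> snd c ` ?B"
    by (rule eventually_mono)
  then have "emeasure lborel (snd c ` ?B) = 0"
    using chart_image_borel[OF cA(1), of ?B] B by (simp add: AE_iff_measurable[OF _ refl])
  then have "negligible (snd c ` ?B)"
    using chart_image_borel[OF cA(1), of ?B] B
    by (simp add: negligible_iff_emeasure0)
  then show False
    using open_chart_image[OF ch B] x cA(2) open_not_negligible[of "snd c ` ?B"] by auto
qed

lemma volume_singleton:
  assumes "{x} \<in> sets borel"
  shows "emeasure \<mu> {x} = 0"
proof -
  obtain c where c: "c \<in> charts_at A x" using smooth_atlasD(2)[OF atlas] by blast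
  have "emeasure \<mu> {x} = (\<integral>\<^sup>+u\<in>{snd c x}. ennreal (\<rho> c u) \<partial>lborel)"
    using emeasure_volume[OF charts_atD(1)[OF c] assms] charts_atD(2)[OF c]
    by (simp add: chart_volume_def)
  also have "\<dots> = 0"
    by (simp add: nn_integral_null_set[of "{snd c x}"] null_sets_def)
  finally show ?thesis .
qed

text \<open>A continuous density is bounded on a small closed ball around the image of the point.\<close>

lemma volume_locally_finite: "\<exists>W. open W \<and> x \<in> W \<and> emeasure \<mu> W < \<infinity>"
proof -
  obtain c where c: "c \<in> charts_at A x" using smooth_atlasD(2)[OF atlas] by blast
  note cA = charts_atD[OF c] and ch = chart[OF charts_atD(1)[OF c]]
  obtain e where e: "e > 0" "cball (snd c x) e \<subseteq> snd c ` fst c"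
    using is_chartD(2)[OF ch] cA(2) open_contains_cball by blast
  have "compact (\<rho> c ` cball (snd c x) e)"
    by (intro compact_continuous_image continuous_on_subset[OF density_continuous[OF cA(1)] e(2)]) simp
  then obtain K where K: "\<And>u. u \<in> cball (snd c x) e \<Longrightarrow> \<rho> c u \<le> K"
    by (meson bdd_above.E bounded_imp_bdd_above compact_imp_bounded image_eqI)
  let ?V = "ball (snd c x) e"
  let ?W = "chart_inv c ` ?V"
  have V: "?V \<subseteq> snd c ` fst c" using e(2) ball_subset_cball by blast
  have W: "open ?W" by (intro open_chart_inv_image ch V) simp
  have im: "snd c ` ?W = ?V"
    using V is_chartD(4)[OF ch] by (force simp: image_image subset_iff)
  have "emeasure \<mu> ?W = chart_volume c ?W"
    using W V is_chartD(5)[OF ch] by (intro emeasure_volume cA) auto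
  also have "\<dots> \<le> (\<integral>\<^sup>+u. ennreal K * indicator ?V u \<partial>lborel)"
    unfolding chart_volume_def im using K
    by (intro nn_integral_mono) (auto simp: indicator_def ennreal_leI)
  also have "\<dots> = ennreal K * emeasure lborel ?V"
    by (simp add: nn_integral_cmult_indicator)
  also have "\<dots> < \<infinity>"
    using emeasure_bounded_finite[of ?V] by (simp add: ennreal_mult_less_top)
  finally have "emeasure \<mu> ?W < \<infinity>" .
  moreover have "x \<in> ?W"
    using is_chartD(3)[OF ch cA(2)] e(1) by (metis centre_in_ball imageI)
  ultimately show ?thesis using W by blast
qed

lemma finite_volume:
  assumes "compact (UNIV :: 'm set)"
  shows "finite_measure \<mu>"
proof (rule finite_measureI)
  let ?F = "{W. open W \<and> emeasure \<mu> W < \<infinity>}"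
  have "UNIV \<subseteq> \<Union>?F" using volume_locally_finite by blast
  then obtain F where F: "F \<subseteq> ?F" "finite F" "UNIV \<subseteq> \<Union>F"
    using compactE[OF assms] by (metis (no_types, lifting) mem_Collect_eq)
  have "emeasure \<mu> (\<Union>W\<in>F. W) \<le> (\<Sum>W\<in>F. emeasure \<mu> W)"
    using F by (intro emeasure_subadditive_finite) (auto simp: sets_volume)
  also have "\<dots> < \<infinity>"
    using F by (simp add: subset_iff)
  finally show "emeasure \<mu> (space \<mu>) \<noteq> \<infinity>"
    using F(3) sets_eq_imp_space_eq[OF sets_volume] by (simp add: top.extremum_unique)
qed

end

end

section \<open>The Riemannian volume of an embedded manifold\<close>

lemma chart_density_pullback:
  fixes A :: "('m::second_countable_topology, real^'d) chart set" and F :: "'m \<Rightarrow> real^'n"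
  assumes A: "smooth_atlas A" and F: "Ck_embedding 2 A F"
  shows "chart_density A (\<lambda>c u. sqrt (det (metric_matrix A (pullback_metric A F) c (chart_inv c u))))"
proof
  let ?G = "metric_matrix A (pullback_metric A F)"
  have map: "Ck_map 2 A F" using F by (simp add: Ck_embedding_def)
  have two: "(2::nat) = Suc 1" by simp
  show "smooth_atlas A" by (rule A)
  show "continuous_on (snd c ` fst c) (\<lambda>u. sqrt (det (?G c (chart_inv c u))))" if "c \<in> A" for c
    by (intro continuous_on_real_sqrt continuous_on_det_metric_matrix A map that)
  show "0 < sqrt (det (?G c (chart_inv c (snd c x))))" if "c \<in> A" "x \<in> fst c" for c x
    using det_metric_matrix_pos[OF A F[unfolded two] charts_atI[OF that]]
      is_chartD(3)[OF smooth_atlasD(1)[OF A that(1)] that(2)] by simp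
  show "sqrt (det (?G c (chart_inv c (snd c x)))) =
      \<bar>det (matrix (transition_diff x c c'))\<bar> * sqrt (det (?G c' (chart_inv c' (snd c' x))))"
    if c: "c \<in> charts_at A x" "c' \<in> charts_at A x" for c c' x
  proof -
    have "chart_inv c (snd c x) = x" "chart_inv c' (snd c' x) = x"
      using is_chartD(3) smooth_atlasD(1)[OF A] charts_atD[OF c(1)] charts_atD[OF c(2)] by blast+
    then show ?thesis
      using det_metric_matrix_change_chart[OF A map[unfolded two] c]
      by (simp add: real_sqrt_mult)
  qed
qed

text \<open>The definition of \<open>riemannian_volume\<close> by a definite description is meaningful because the
  glued measure exists and is unique.\<close>

lemma is_volume_riemannian_volume:
  fixes A :: "('m::second_countable_topology, real^'d) chart set" and F :: "'m \<Rightarrow> real^'n"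
  assumes A: "smooth_atlas A" and F: "Ck_embedding 2 A F"
  defines "\<rho> \<equiv> \<lambda>c u. sqrt (det (metric_matrix A (pullback_metric A F) c (chart_inv c u)))"
  shows "chart_density.is_volume A \<rho> (riemannian_volume A (pullback_metric A F))"
proof -
  interpret chart_density A \<rho>
    unfolding \<rho>_def by (rule chart_density_pullback[OF A F])
  have "riemannian_volume A (pullback_metric A F) = (THE \<mu>. is_volume \<mu>)"
    unfolding riemannian_volume_def is_volume_def[abs_def] chart_volume_def unfolding \<rho>_def ..
  moreover have "\<exists>!\<mu>. is_volume \<mu>"
    using volume_exists volume_unique by blast
  ultimately show ?thesis
    using theI'[of is_volume] by simp
qed

lemma riemannian_volume_embedding:
  fixes A :: "('m::{t2_space, second_countable_topology}, real^'d) chart set" and F :: "'m \<Rightarrow> real^'n"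
  assumes A: "smooth_atlas A" and F: "Ck_embedding 2 A F"
  defines "\<mu> \<equiv> riemannian_volume A (pullback_metric A F)"
  shows "sets \<mu> = sets borel"
    and "\<And>x. emeasure \<mu> {x} = 0"
    and "\<And>W. open W \<Longrightarrow> W \<noteq> {} \<Longrightarrow> emeasure \<mu> W \<noteq> 0"
    and "compact (UNIV :: 'm set) \<Longrightarrow> finite_measure \<mu>"
proof -
  interpret chart_density A "\<lambda>c u. sqrt (det (metric_matrix A (pullback_metric A F) c (chart_inv c u)))"
    by (rule chart_density_pullback[OF A F])
  have vol: "is_volume \<mu>"
    unfolding \<mu>_def by (rule is_volume_riemannian_volume[OF A F])
  show "sets \<mu> = sets borel" by (rule sets_volume[OF vol])
  show "emeasure \<mu> {x} = 0" for x
    by (rule volume_singleton[OF vol]) simp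
  show "emeasure \<mu> W \<noteq> 0" if "open W" "W \<noteq> {}" for W
    using volume_open_pos[OF vol] that .
  show "finite_measure \<mu>" if "compact (UNIV :: 'm set)"
    using finite_volume[OF vol that] .
qed

section \<open>Determining continuous densities and measures\<close>

lemma borel_measurable_continuous_cong_sets:
  fixes f :: "'m::topological_space \<Rightarrow> 'b::topological_space"
  assumes "sets \<mu> = sets borel" "continuous_on UNIV f"
  shows "f \<in> borel_measurable \<mu>"
  unfolding measurable_cong_sets[OF assms(1) refl]
  by (rule borel_measurable_continuous_onI[OF assms(2)])

text \<open>Equal densities agree almost everywhere; the set where two continuous ones differ is open, and
  so it is empty when nonempty open sets have positive measure.\<close>

lemma continuous_eqI_density:
  fixes f g :: "'m::topological_space \<Rightarrow> real"
  assumes sets: "sets \<mu> = sets borel" and fin: "finite_measure \<mu>"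
    and pos: "\<And>W. open W \<Longrightarrow> W \<noteq> {} \<Longrightarrow> emeasure \<mu> W \<noteq> 0"
    and f: "continuous_on UNIV f" "\<And>x. 0 \<le> f x" and g: "continuous_on UNIV g" "\<And>x. 0 \<le> g x"
    and eq: "density \<mu> (\<lambda>x. ennreal (f x)) = density \<mu> (\<lambda>x. ennreal (g x))"
  shows "f = g"
proof -
  interpret finite_measure \<mu> by (rule fin)
  have [measurable]: "f \<in> borel_measurable \<mu>" "g \<in> borel_measurable \<mu>"
    using borel_measurable_continuous_cong_sets[OF sets] f g by auto
  have "AE x in \<mu>. ennreal (f x) = ennreal (g x)"
    by (rule density_unique[OF _ _ eq]) auto
  then have "AE x in \<mu>. f x = g x"
    using f(2) g(2) by simp
  moreover have W: "open {x. f x \<noteq> g x}"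
    using f(1) g(1) by (intro open_Collect_neq)
  moreover have "space \<mu> = UNIV"
    using sets_eq_imp_space_eq[OF sets] by simp
  ultimately have "emeasure \<mu> {x. f x \<noteq> g x} = 0"
    by (subst (asm) AE_iff_measurable[OF _ refl]) (simp_all add: sets)
  then have "{x. f x \<noteq> g x} = {}" using pos W by blast
  then show ?thesis by auto
qed

lemma finite_measure_eqI_open:
  fixes \<mu> \<nu> :: "'m::topological_space measure"
  assumes sets: "sets \<mu> = sets borel" "sets \<nu> = sets borel" and fin: "finite_measure \<mu>"
    and eq: "\<And>W. open W \<Longrightarrow> emeasure \<mu> W = emeasure \<nu> W"
  shows "\<mu> = \<nu>"
proof (rule measure_eqI_generator_eq[where E = "{W. open W}" and \<Omega> = UNIV and A = "\<lambda>_. UNIV"])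
  show "Int_stable {W :: 'm set. open W}" by (auto simp: Int_stable_def)
  show "sets \<mu> = sigma_sets UNIV {W. open W}" "sets \<nu> = sigma_sets UNIV {W. open W}"
    using sets by (simp_all add: borel_def)
  show "emeasure \<mu> UNIV \<noteq> \<infinity>" for i :: nat
    using finite_measure.emeasure_finite[OF fin] by simp
qed (use eq in auto)

text \<open>The indicator of an open set \<open>W\<close> is the increasing limit of the functions
  \<open>min 1 (n * infdist (F y) (F ` (- W)))\<close>, where the injection \<open>F\<close> into a metric space replaces a
  metric on the domain. They vanish off \<open>W\<close>, in particular at \<open>x\<close>.\<close>

lemma emeasure_open_cong:
  fixes F :: "'m::topological_space \<Rightarrow> 'b::metric_space"
  assumes compact: "compact (UNIV :: 'm set)" and F: "continuous_on UNIV F" "inj F"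
    and sets: "sets \<mu> = sets borel" "sets \<nu> = sets borel"
    and fin: "finite_measure \<mu>" "finite_measure \<nu>"
    and int: "\<And>f :: 'm \<Rightarrow> real. continuous_on UNIV f \<Longrightarrow> f x = 0 \<Longrightarrow> (\<integral>y. f y \<partial>\<mu>) = (\<integral>y. f y \<partial>\<nu>)"
    and W: "open W" "x \<notin> W"
  shows "emeasure \<mu> W = emeasure \<nu> W"
proof -
  let ?K = "F ` (- W)"
  define f where "f n y = min 1 (real n * infdist (F y) ?K)" for n y
  have cont: "continuous_on UNIV (f n)" for n
    unfolding f_def using F(1) by (intro continuous_intros)
  have "compact (- W)"
    using compact W(1) by (metis closed_Compl compact_Int_closed inf_top_left)
  then have "closed ?K"
    using F(1) by (intro compact_imp_closed compact_continuous_image) (auto intro: continuous_on_subset)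
  have zero: "f n y = 0" if "y \<notin> W" for n y
    using that by (simp add: f_def)
  have lim: "(\<lambda>n. f n y) \<longlonglongrightarrow> indicator W y" for y
  proof (cases "y \<in> W")
    case True
    have "F y \<notin> ?K" using True F(2) by (auto simp: inj_eq)
    then have pos: "0 < infdist (F y) ?K"
      using \<open>closed ?K\<close> W(2) infdist_pos_not_in_closed by blast
    then obtain N where "1 < real N * infdist (F y) ?K"
      using reals_Archimedean3 by blast
    then have "1 \<le> real n * infdist (F y) ?K" if "n \<ge> N" for n
      using that pos by (meson less_imp_le mult_right_mono of_nat_mono order_trans)
    then have "\<forall>\<^sub>F n in sequentially. f n y = 1"
      by (auto simp: f_def eventually_sequentially min_def)
    then show ?thesis using True by (simp add: tendsto_eventually)
  qed (simp add: zero)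
  have *: "(\<lambda>n. \<integral>y. f n y \<partial>\<kappa>) \<longlonglongrightarrow> measure \<kappa> W" if \<kappa>: "sets \<kappa> = sets borel" "finite_measure \<kappa>" for \<kappa>
  proof -
    interpret finite_measure \<kappa> by (rule \<kappa>)
    have "(\<lambda>n. \<integral>y. f n y \<partial>\<kappa>) \<longlonglongrightarrow> (\<integral>y. indicator W y \<partial>\<kappa>)"
    proof (rule integral_dominated_convergence[where w = "\<lambda>_. 1"])
      show "f n \<in> borel_measurable \<kappa>" for n
        by (rule borel_measurable_continuous_cong_sets[OF \<kappa>(1) cont])
      show "(indicator W :: 'm \<Rightarrow> real) \<in> borel_measurable \<kappa>"
        using \<kappa>(1) W(1) by (intro borel_measurable_indicator) simp
      show "AE y in \<kappa>. norm (f n y) \<le> 1" for n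
        by (rule AE_I2) (simp add: f_def infdist_nonneg)
    qed (simp_all add: lim)
    then show ?thesis by (simp add: sets_eq_imp_space_eq[OF \<kappa>(1)])
  qed
  have "(\<integral>y. f n y \<partial>\<mu>) = (\<integral>y. f n y \<partial>\<nu>)" for n
    using int[OF cont zero[OF W(2)]] .
  then have "measure \<mu> W = measure \<nu> W"
    using *[OF sets(1) fin(1)] *[OF sets(2) fin(2)] by (simp add: LIMSEQ_unique)
  then show ?thesis
    using fin by (simp add: finite_measure.emeasure_eq_measure)
qed

text \<open>Test functions that vanish at \<open>x\<close> determine the measure away from \<open>x\<close>; an atom at \<open>x\<close> is the
  only thing they cannot detect.\<close>

lemma finite_measure_eqI_vanishing:
  fixes F :: "'m::t1_space \<Rightarrow> 'b::metric_space"
  assumes compact: "compact (UNIV :: 'm set)" and F: "continuous_on UNIV F" "inj F"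
    and sets: "sets \<mu> = sets borel" "sets \<nu> = sets borel"
    and fin: "finite_measure \<mu>" "finite_measure \<nu>"
    and null: "emeasure \<mu> {x} = 0" "emeasure \<nu> {x} = 0"
    and int: "\<And>f :: 'm \<Rightarrow> real. continuous_on UNIV f \<Longrightarrow> f x = 0 \<Longrightarrow> (\<integral>y. f y \<partial>\<mu>) = (\<integral>y. f y \<partial>\<nu>)"
  shows "\<mu> = \<nu>"
proof (rule finite_measure_eqI_open[OF sets fin(1)])
  fix W :: "'m set" assume W: "open W"
  have "emeasure \<kappa> (W - {x}) = emeasure \<kappa> W" if "sets \<kappa> = sets borel" "emeasure \<kappa> {x} = 0" for \<kappa>
    using that W by (intro emeasure_Diff_null_set) (auto simp: null_sets_def)
  moreover have "emeasure \<mu> (W - {x}) = emeasure \<nu> (W - {x})"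
    using W by (intro emeasure_open_cong[OF compact F sets fin int]) auto
  ultimately show "emeasure \<mu> W = emeasure \<nu> W"
    using sets null by simp
qed

lemma finite_measure_density_continuous:
  fixes f :: "'m::topological_space \<Rightarrow> real"
  assumes compact: "compact (UNIV :: 'm set)" and sets: "sets \<mu> = sets borel" and fin: "finite_measure \<mu>"
    and f: "continuous_on UNIV f"
  shows "finite_measure (density \<mu> (\<lambda>x. ennreal (f x)))"
proof (rule finite_measureI)
  have [measurable]: "f \<in> borel_measurable \<mu>"
    by (rule borel_measurable_continuous_cong_sets[OF sets f])
  have "compact (range f)" using compact f by (rule compact_continuous_image[rotated])
  then obtain C where C: "\<And>x. f x \<le> C"
    by (meson bdd_above.E bounded_imp_bdd_above compact_imp_bounded rangeI)
  have "emeasure (density \<mu> (\<lambda>x. ennreal (f x))) (space \<mu>) = (\<integral>\<^sup>+x. ennreal (f x) * indicator (space \<mu>) x \<partial>\<mu>)"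
    by (rule emeasure_density) auto
  also have "\<dots> \<le> (\<integral>\<^sup>+x. ennreal C \<partial>\<mu>)"
    using C by (intro nn_integral_mono) (auto simp: indicator_def ennreal_leI)
  also have "\<dots> < \<infinity>"
    using finite_measure.emeasure_finite[OF fin] by (simp add: ennreal_mult_less_top less_top)
  finally show "emeasure (density \<mu> (\<lambda>x. ennreal (f x))) (space (density \<mu> (\<lambda>x. ennreal (f x)))) \<noteq> \<infinity>"
    by simp
qed

section \<open>Isometric embeddings induce the same metric\<close>

lemma has_derivative_imp_directional_tendsto:
  fixes f :: "'a::real_normed_vector \<Rightarrow> 'b::real_normed_vector"
  assumes f: "(f has_derivative D) (at a)"
  shows "((\<lambda>s. (f (a + s *\<^sub>R v) - f a) /\<^sub>R s) \<longlongrightarrow> D v) (at (0::real))"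
proof -
  have "((\<lambda>s::real. a + s *\<^sub>R v) has_derivative (\<lambda>s. s *\<^sub>R v)) (at 0)"
    by (auto intro!: derivative_eq_intros)
  then have "((\<lambda>s::real. f (a + s *\<^sub>R v)) has_derivative (\<lambda>s. D (s *\<^sub>R v))) (at 0)"
    by (rule has_derivative_compose) (use f in simp)
  then have "((\<lambda>s::real. norm (f (a + s *\<^sub>R v) - f a - D (s *\<^sub>R v)) / norm s) \<longlongrightarrow> 0) (at 0)"
    by (simp add: has_derivative_at)
  moreover have "norm (f (a + s *\<^sub>R v) - f a - D (s *\<^sub>R v)) / norm s =
      norm ((f (a + s *\<^sub>R v) - f a) /\<^sub>R s - D v)" if "s \<noteq> 0" for s
  proof -
    have "f (a + s *\<^sub>R v) - f a - D (s *\<^sub>R v) = s *\<^sub>R ((f (a + s *\<^sub>R v) - f a) /\<^sub>R s - D v)"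
      using that by (simp add: linear_scale[OF has_derivative_linear[OF f]] scaleR_right_diff_distrib)
    then show ?thesis using that by simp
  qed
  ultimately have "((\<lambda>s. norm ((f (a + s *\<^sub>R v) - f a) /\<^sub>R s - D v)) \<longlongrightarrow> 0) (at 0)"
    by (elim Lim_transform_eventually) (auto simp: eventually_at_filter)
  then show ?thesis
    by (rule Lim_null[THEN iffD2, OF tendsto_norm_zero_cancel])
qed

lemma isometric_imp_norm_derivative_eq:
  fixes f\<^sub>1 f\<^sub>2 :: "'a::real_normed_vector \<Rightarrow> 'b::real_normed_vector"
  assumes f: "(f\<^sub>1 has_derivative D\<^sub>1) (at a)" "(f\<^sub>2 has_derivative D\<^sub>2) (at a)"
    and iso: "\<And>u. norm (f\<^sub>1 u - f\<^sub>1 a) = norm (f\<^sub>2 u - f\<^sub>2 a)"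
  shows "norm (D\<^sub>1 v) = norm (D\<^sub>2 v)"
proof (rule tendsto_unique)
  show "((\<lambda>s. norm ((f\<^sub>1 (a + s *\<^sub>R v) - f\<^sub>1 a) /\<^sub>R s)) \<longlongrightarrow> norm (D\<^sub>1 v)) (at (0::real))"
    by (intro tendsto_norm has_derivative_imp_directional_tendsto f)
  show "((\<lambda>s. norm ((f\<^sub>1 (a + s *\<^sub>R v) - f\<^sub>1 a) /\<^sub>R s)) \<longlongrightarrow> norm (D\<^sub>2 v)) (at (0::real))"
    using tendsto_norm[OF has_derivative_imp_directional_tendsto[OF f(2), of v]] by (simp add: iso)
qed simp

text \<open>Equal distances give equal difference quotients in norm, hence equal norms of the
  differentials of tangent vectors; polarization gives equal inner products.\<close>

lemma isometric_imp_pullback_metric_eq: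
  fixes A :: "('m::topological_space, 'e::euclidean_space) chart set" and F\<^sub>1 F\<^sub>2 :: "'m \<Rightarrow> 'b::euclidean_space"
  assumes A: "smooth_atlas A" and F: "Ck_map (Suc k) A F\<^sub>1" "Ck_map (Suc k) A F\<^sub>2"
    and iso: "\<And>x y. norm (F\<^sub>1 x - F\<^sub>1 y) = norm (F\<^sub>2 x - F\<^sub>2 y)"
  shows "pullback_metric A F\<^sub>1 = pullback_metric A F\<^sub>2"
proof (intro ext)
  fix x and v w :: "('m, 'e) tangent_vector"
  define c where "c = (SOME c. c \<in> charts_at A x)"
  have c: "c \<in> charts_at A x"
    unfolding c_def using smooth_atlasD(2)[OF A] by (rule someI_ex)
  let ?D = "\<lambda>F. frechet_derivative (F \<circ> chart_inv c) (at (snd c x))"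
  note D = Ck_map_has_derivative[OF F(1) c] Ck_map_has_derivative[OF F(2) c]
  have norm: "norm (?D F\<^sub>1 u) = norm (?D F\<^sub>2 u)" for u
    by (rule isometric_imp_norm_derivative_eq[OF D]) (simp add: iso)
  have "?D F\<^sub>1 u \<bullet> ?D F\<^sub>1 u' = ?D F\<^sub>2 u \<bullet> ?D F\<^sub>2 u'" for u u'
    using norm[of u] norm[of u'] norm[of "u + u'"]
    by (simp add: dot_norm linear_add[OF has_derivative_linear[OF D(1)]]
        linear_add[OF has_derivative_linear[OF D(2)]])
  then show "pullback_metric A F\<^sub>1 x v w = pullback_metric A F\<^sub>2 x v w"
    by (simp add: pullback_metric_def differential_def Let_def c_def[symmetric])
qed

section \<open>The operator determines the geometry\<close>

text \<open>At a zero of \<open>f\<close> the term with \<open>f x\<close>, which carries the total mass of the kernel measure, drops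
  out, and the operator only integrates \<open>f\<close> against that measure.\<close>

lemma L_ext_vanishing:
  fixes A :: "('m::topological_space, real^'d) chart set"
  assumes "f x = 0"
  shows "L_ext A t p g F f x = - (1 / t powr (real CARD('d) / 2 + 1)) *
    (\<integral>y. (gauss_kernel t F x y * p y) * f y \<partial>riemannian_volume A g)"
proof -
  have "(\<lambda>y. gauss_kernel t F x y * (f x - f y) * p y) = (\<lambda>y. - (gauss_kernel t F x y * p y * f y))"
    using assms by (auto simp: algebra_simps)
  then show ?thesis by (simp add: L_ext_def)
qed

theorem theorem3p8:
  fixes A :: "('m::{t2_space, second_countable_topology}, real^'d) chart set"
    and \<iota>\<^sub>1 \<iota>\<^sub>2 :: "'m \<Rightarrow> real^'D"
    and p\<^sub>1 p\<^sub>2 :: "'m \<Rightarrow> real"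
    and t :: real
  defines "g\<^sub>1 \<equiv> pullback_metric A \<iota>\<^sub>1"
    and "g\<^sub>2 \<equiv> pullback_metric A \<iota>\<^sub>2"
  assumes "compact (UNIV :: 'm set)"
    and "smooth_atlas A"
    and "t > 0"
    and "Ck_embedding 2 A \<iota>\<^sub>1"
    and "Ck_embedding 2 A \<iota>\<^sub>2"
    and "continuous_on UNIV p\<^sub>1" and "\<And>x. p\<^sub>1 x > 0"
    and "continuous_on UNIV p\<^sub>2" and "\<And>x. p\<^sub>2 x > 0"
    and "\<And>f x. continuous_on UNIV f \<Longrightarrow>
           L_ext A t p\<^sub>1 g\<^sub>1 \<iota>\<^sub>1 f x = L_ext A t p\<^sub>2 g\<^sub>2 \<iota>\<^sub>2 f x"
  shows "(\<forall>x y. norm (\<iota>\<^sub>1 x - \<iota>\<^sub>1 y) = norm (\<iota>\<^sub>2 x - \<iota>\<^sub>2 y)) \<and>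
         (\<forall>x. \<forall>v\<in>tangent_space A x. \<forall>w\<in>tangent_space A x. g\<^sub>1 x v w = g\<^sub>2 x v w) \<and>
         riemannian_volume A g\<^sub>1 = riemannian_volume A g\<^sub>2 \<and>
         p\<^sub>1 = p\<^sub>2"
proof -
  note compact = assms(3) and A = assms(4) and t = assms(5) and emb = assms(6,7)
    and p\<^sub>1 = assms(8,9) and p\<^sub>2 = assms(10,11) and L = assms(12)
  let ?\<mu>\<^sub>1 = "riemannian_volume A g\<^sub>1" and ?\<mu>\<^sub>2 = "riemannian_volume A g\<^sub>2"
  let ?K\<^sub>1 = "gauss_kernel t \<iota>\<^sub>1" and ?K\<^sub>2 = "gauss_kernel t \<iota>\<^sub>2"
  note vol\<^sub>1 = riemannian_volume_embedding[OF A emb(1), folded g\<^sub>1_def]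
    and vol\<^sub>2 = riemannian_volume_embedding[OF A emb(2), folded g\<^sub>2_def]
  note fin\<^sub>1 = vol\<^sub>1(4)[OF compact] and fin\<^sub>2 = vol\<^sub>2(4)[OF compact]
  note meas\<^sub>1 = borel_measurable_continuous_cong_sets[OF vol\<^sub>1(1)]
    and meas\<^sub>2 = borel_measurable_continuous_cong_sets[OF vol\<^sub>2(1)]
  have \<iota>: "continuous_on UNIV \<iota>\<^sub>1" "continuous_on UNIV \<iota>\<^sub>2" "inj \<iota>\<^sub>1"
    using emb by (auto simp: Ck_embedding_def homeomorphism_def intro: inj_on_inverseI)
  have K_cont: "continuous_on UNIV (?K\<^sub>1 x)" "continuous_on UNIV (?K\<^sub>2 x)" for x
    unfolding gauss_kernel_def[abs_def] using t by (intro continuous_intros \<iota>; simp)+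
  have K_pos: "0 < ?K\<^sub>1 x y" "0 < ?K\<^sub>2 x y" for x y
    by (simp_all add: gauss_kernel_def)
  have K_diag: "?K\<^sub>1 x x = 1" "?K\<^sub>2 x x = 1" for x
    by (simp_all add: gauss_kernel_def)
  have Kp_cont: "continuous_on UNIV (\<lambda>y. ?K\<^sub>1 x y * p\<^sub>1 y)" "continuous_on UNIV (\<lambda>y. ?K\<^sub>2 x y * p\<^sub>2 y)" for x
    by (intro continuous_on_mult K_cont p\<^sub>1 p\<^sub>2)+
  have Kp_nonneg: "0 \<le> ?K\<^sub>1 x y * p\<^sub>1 y" "0 \<le> ?K\<^sub>2 x y * p\<^sub>2 y" for x y
    by (intro mult_nonneg_nonneg less_imp_le K_pos p\<^sub>1 p\<^sub>2)+
  let ?E\<^sub>1 = "\<lambda>x. density ?\<mu>\<^sub>1 (\<lambda>y. ennreal (?K\<^sub>1 x y * p\<^sub>1 y))"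
    and ?E\<^sub>2 = "\<lambda>x. density ?\<mu>\<^sub>2 (\<lambda>y. ennreal (?K\<^sub>2 x y * p\<^sub>2 y))"
  \<comment> \<open>The operators see these measures on test functions that vanish at \<open>x\<close>, and points are null.\<close>
  have E: "?E\<^sub>1 x = ?E\<^sub>2 x" for x
  proof (rule finite_measure_eqI_vanishing[OF compact \<iota>(1,3)])
    show "sets (?E\<^sub>1 x) = sets borel" "sets (?E\<^sub>2 x) = sets borel"
      using vol\<^sub>1(1) vol\<^sub>2(1) by simp_all
    show "finite_measure (?E\<^sub>1 x)" "finite_measure (?E\<^sub>2 x)"
      by (intro finite_measure_density_continuous compact vol\<^sub>1(1) vol\<^sub>2(1) fin\<^sub>1 fin\<^sub>2 Kp_cont)+
    have "{x} \<in> null_sets ?\<mu>\<^sub>1" "{x} \<in> null_sets ?\<mu>\<^sub>2"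
      using vol\<^sub>1(1,2) vol\<^sub>2(1,2) by (simp_all add: null_sets_def)
    then show "emeasure (?E\<^sub>1 x) {x} = 0" "emeasure (?E\<^sub>2 x) {x} = 0"
      using vol\<^sub>1(1) vol\<^sub>2(1) meas\<^sub>1[OF Kp_cont(1)] meas\<^sub>2[OF Kp_cont(2)]
      by (simp_all add: emeasure_density nn_integral_null_set vol\<^sub>1(2) vol\<^sub>2(2))
    fix f :: "'m \<Rightarrow> real" assume f: "continuous_on UNIV f" "f x = 0"
    have "(\<integral>y. (?K\<^sub>1 x y * p\<^sub>1 y) * f y \<partial>?\<mu>\<^sub>1) = (\<integral>y. (?K\<^sub>2 x y * p\<^sub>2 y) * f y \<partial>?\<mu>\<^sub>2)"
      using L[OF f(1), of x] t unfolding L_ext_vanishing[of f x, OF f(2)] by simp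
    moreover have "(\<integral>y. f y \<partial>?E\<^sub>1 x) = (\<integral>y. (?K\<^sub>1 x y * p\<^sub>1 y) * f y \<partial>?\<mu>\<^sub>1)"
      by (subst integral_density) (auto intro!: meas\<^sub>1 Kp_cont f(1) Kp_nonneg)
    moreover have "(\<integral>y. f y \<partial>?E\<^sub>2 x) = (\<integral>y. (?K\<^sub>2 x y * p\<^sub>2 y) * f y \<partial>?\<mu>\<^sub>2)"
      by (subst integral_density) (auto intro!: meas\<^sub>2 Kp_cont f(1) Kp_nonneg)
    ultimately show "(\<integral>y. f y \<partial>?E\<^sub>1 x) = (\<integral>y. f y \<partial>?E\<^sub>2 x)" by simp
  qed
  have cross: "?K\<^sub>1 x y * ?K\<^sub>2 x' y = ?K\<^sub>1 x' y * ?K\<^sub>2 x y" for x x' y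
  proof -
    \<comment> \<open>Multiplication by this ratio turns \<open>?E\<^sub>2 x\<close> into \<open>?E\<^sub>2 x'\<close>.\<close>
    let ?q = "\<lambda>y. ?K\<^sub>2 x' y / ?K\<^sub>2 x y"
    have q: "continuous_on UNIV ?q" "\<And>y. 0 \<le> ?q y"
      using K_cont K_pos by (auto intro!: continuous_on_divide simp: less_imp_le less_imp_neq[symmetric])
    have "density ?\<mu>\<^sub>1 (\<lambda>y. ennreal (?K\<^sub>1 x y * p\<^sub>1 y * ?q y)) = density (?E\<^sub>1 x) (\<lambda>y. ennreal (?q y))"
      unfolding ennreal_mult'[OF Kp_nonneg(1)]
      by (intro density_density_eq[symmetric] measurable_compose[OF _ measurable_ennreal] meas\<^sub>1 Kp_cont q)
    also have "\<dots> = density (?E\<^sub>2 x) (\<lambda>y. ennreal (?q y))" by (simp only: E)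
    also have "\<dots> = density ?\<mu>\<^sub>2 (\<lambda>y. ennreal (?K\<^sub>2 x y * p\<^sub>2 y * ?q y))"
      unfolding ennreal_mult'[OF Kp_nonneg(2)]
      by (intro density_density_eq measurable_compose[OF _ measurable_ennreal] meas\<^sub>2 Kp_cont q)
    also have "(\<lambda>y. ?K\<^sub>2 x y * p\<^sub>2 y * ?q y) = (\<lambda>y. ?K\<^sub>2 x' y * p\<^sub>2 y)"
      using K_pos(2) by (auto simp: field_simps less_imp_neq[symmetric])
    also have "density ?\<mu>\<^sub>2 (\<lambda>y. ennreal (?K\<^sub>2 x' y * p\<^sub>2 y)) = ?E\<^sub>1 x'" by (simp only: E)
    finally have "(\<lambda>y. ?K\<^sub>1 x y * p\<^sub>1 y * ?q y) = (\<lambda>y. ?K\<^sub>1 x' y * p\<^sub>1 y)"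
      by (intro continuous_eqI_density[OF vol\<^sub>1(1) fin\<^sub>1 vol\<^sub>1(3)] continuous_on_mult Kp_cont q
          mult_nonneg_nonneg[OF Kp_nonneg(1) q(2)] Kp_nonneg)
    then have "?K\<^sub>1 x y * p\<^sub>1 y * ?q y = ?K\<^sub>1 x' y * p\<^sub>1 y" by (rule fun_cong)
    then show ?thesis
      using p\<^sub>1(2)[of y] K_pos(2)[of x y] by (simp add: field_simps)
  qed
  \<comment> \<open>The choice \<open>x' = y\<close>: both kernels are \<open>1\<close> on the diagonal.\<close>
  have K: "?K\<^sub>1 x y = ?K\<^sub>2 x y" for x y
    using cross[of x y y] by (simp add: K_diag)
  have dist: "norm (\<iota>\<^sub>1 x - \<iota>\<^sub>1 y) = norm (\<iota>\<^sub>2 x - \<iota>\<^sub>2 y)" for x y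
    using K[of x y] t by (simp add: gauss_kernel_def)
  have "Ck_map (Suc 1) A \<iota>\<^sub>1" "Ck_map (Suc 1) A \<iota>\<^sub>2"
    using emb by (simp_all add: Ck_embedding_def numeral_2_eq_2)
  then have g: "g\<^sub>1 = g\<^sub>2"
    unfolding g\<^sub>1_def g\<^sub>2_def by (rule isometric_imp_pullback_metric_eq[OF A]) (rule dist)
  have "(\<lambda>y. ?K\<^sub>1 x y * p\<^sub>1 y) = (\<lambda>y. ?K\<^sub>1 x y * p\<^sub>2 y)" for x
  proof (rule continuous_eqI_density[OF vol\<^sub>1(1) fin\<^sub>1 vol\<^sub>1(3)])
    show "density ?\<mu>\<^sub>1 (\<lambda>y. ennreal (?K\<^sub>1 x y * p\<^sub>1 y)) = density ?\<mu>\<^sub>1 (\<lambda>y. ennreal (?K\<^sub>1 x y * p\<^sub>2 y))"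
      using E[of x] by (simp add: K g)
  qed (use Kp_cont Kp_nonneg K in \<open>simp_all add: K\<close>)
  then have "?K\<^sub>1 x y * p\<^sub>1 y = ?K\<^sub>1 x y * p\<^sub>2 y" for x y
    by (rule fun_cong)
  then have "p\<^sub>1 = p\<^sub>2"
    using K_pos(1) by (auto simp: less_imp_neq[symmetric])
  then show ?thesis using dist g by simp
qed

end
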